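(* Let $G$ be a compact abelian group. For any $\varepsilon > 0$, there exists $\delta > 0$ with the following property: if $F : G^2 \to [0,1]$ is a measurable function such that $\int_{G^2} F\, dm_{G^2} \ge \varepsilon$, then \[ \int_{G^3} F(x,y)\,F(x+t,y)\,F(x,y+t)\,dx\,dy\,dt \ge \delta. \]
   Context: $m_{G^2}$ denotes Haar probability measure on $G^2$, and integration in $dx\,dy\,dt$ is with respect to Haar probability measure on $G$. *)

theory Defs
  imports "HOL-Probability.Probability"
begin

text \<open>
  A product of topological abelian groups, with the product topology and componentwise
  addition, is a topological abelian group; so Haar measures on $G^2$ and $G^3$ are Haar
  measures on the types \<open>'a \<times> 'a\<close> and \<open>'a \<times> 'a \<times> 'a\<close>.
\<close>

instance prod :: (topological_monoid_add, topological_monoid_add) topological_monoid_add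
proof
  fix a b :: "'a \<times> 'b"
  have "((\<lambda>x. (fst (fst x) + fst (snd x), snd (fst x) + snd (snd x)))
          \<longlongrightarrow> (fst a + fst b, snd a + snd b)) (nhds a \<times>\<^sub>F nhds b)"
    by (intro tendsto_intros filterlim_fst filterlim_snd)
  then show "((\<lambda>x. fst x + snd x) \<longlongrightarrow> a + b) (nhds a \<times>\<^sub>F nhds b)"
    by (simp add: plus_prod_def)
qed

instance prod :: (topological_group_add, topological_group_add) topological_group_add
proof
  fix a :: "'a \<times> 'b"
  have "((\<lambda>x. (- fst x, - snd x)) \<longlongrightarrow> (- fst a, - snd a)) (nhds a)"
    by (intro tendsto_intros filterlim_ident)
  then show "(uminus \<longlongrightarrow> - a) (nhds a)"
    by (simp add: uminus_prod_def[abs_def])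
qed

instance prod :: (topological_ab_group_add, topological_ab_group_add) topological_ab_group_add ..

text \<open>
  Regularity is part of the notion: the topology need not be second countable, and without
  it a translation-invariant Borel probability measure need not be unique. For the same
  reason the \<open>\<sigma>\<close>-algebra on a product group is the Borel \<open>\<sigma>\<close>-algebra of the product
  topology, which can be strictly larger than the product of the Borel \<open>\<sigma>\<close>-algebras.
\<close>

definition regular_borel_measure :: "'a::t2_space measure \<Rightarrow> bool" where
  "regular_borel_measure M \<longleftrightarrow>
     sets M = sets borel \<and>
     (\<forall>K. compact K \<longrightarrow> emeasure M K < \<infinity>) \<and>
     (\<forall>B\<in>sets borel. emeasure M B = (INF U\<in>{U. open U \<and> B \<subseteq> U}. emeasure M U)) \<and>
     (\<forall>U. open U \<longrightarrow> emeasure M U = (SUP K\<in>{K. compact K \<and> K \<subseteq> U}. emeasure M K))"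

definition haar_prob_measure :: "'a::{topological_ab_group_add, t2_space} measure \<Rightarrow> bool" where
  "haar_prob_measure M \<longleftrightarrow>
     prob_space M \<and>
     regular_borel_measure M \<and>
     (\<forall>g. \<forall>B\<in>sets borel. emeasure M ((\<lambda>x. g + x) ` B) = emeasure M B)"

end

theory Submission
  imports Defs
begin

text \<open>
  With \<open>z = x + y + t\<close> the integral counts triangles in a tripartite graph on \<open>G\<close>, \<open>G\<close>, \<open>G\<close> whose edge
  \<open>xy\<close>, \<open>yz\<close> or \<open>xz\<close> is present when \<open>(x, y)\<close>, \<open>(z - y, y)\<close> or \<open>(x, z - x)\<close> lies in a given set \<open>E\<close> of
  measure at least \<open>\<epsilon>/2\<close>. The degenerate triangles \<open>z = x + y\<close> can be null, but their law couples three Haar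
  variables so that any two of them are independent, and it charges the set of triangles with mass at
  least \<open>\<epsilon>/2\<close>. A regularity argument shows that any such coupling forces a positive product measure
  of triangles: after regularisation some triple of cells is charged by the coupling and is dense
  in all three graphs, and it then contains many triangles by the counting lemma.

  Approximating the three edge sets in measure by finite unions of open rectangles reduces this to
  finite weighted vertex sets, and removes the difference between the Borel \<open>\<sigma>\<close>-algebra of \<open>G\<^sup>2\<close> and
  the product \<open>\<sigma>\<close>-algebra. Regularity is derived from near-minimisers of the \<open>L\<^sup>2\<close> distance to step
  functions with few steps instead of from conditional expectations.
\<close>

section \<open>Triangles in finite weighted graphs\<close>

text \<open>Closeness in cut norm controls averages against product weights, but it does not compare
  triangle counts under a coupling, which can be concentrated on a set of tiny product weight. What
  the coupling shares with the product weight is its pair marginals, so an error depending on two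
  variables only costs the same under both. Hence each edge function A is split as
  \<open>f + (g - f) + (A - g)\<close>: \<open>f\<close> is constant on boundedly many cells and
  carries the charge of the coupling, \<open>g - f\<close> is small in L1, which the pair marginals
  tolerate, and \<open>A - g\<close> is small in cut norm, which suffices for counting. The cut
  error has to beat the triangle density found in one cell, which shrinks with the number of cells;
  the regularity statement therefore takes it as an arbitrary positive function
  \<open>\<eta>\<close> of \<open>k\<close>, the number of labels of \<open>f\<close>. All bounds
  are independent of the vertex set. This matters because the number of vertices is decided only by
  the rectangle approximation, whose accuracy depends on the \<open>\<delta>\<close> already
  obtained.\<close>

definition unit_valued :: "('b \<Rightarrow> 'c \<Rightarrow> real) \<Rightarrow> bool" where
  "unit_valued A \<longleftrightarrow> (\<forall>x y. 0 \<le> A x y \<and> A x y \<le> 1)"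

section \<open>Step functions with few labels\<close>

text \<open>Partitions are encoded by natural number labels below \<open>k\<close>, so that refining
  them becomes arithmetic on labels and empty cells do no harm.\<close>

definition step_fun :: "nat \<Rightarrow> ('b \<Rightarrow> 'b \<Rightarrow> real) \<Rightarrow> bool" where
  "step_fun k f \<longleftrightarrow> (\<exists>p q a. (\<forall>x. p x < k) \<and> (\<forall>y. q y < k) \<and> unit_valued a \<and>
     f = (\<lambda>x y. a (p x :: nat) (q y :: nat)))"

lemma step_funI:
  fixes p q :: "'b \<Rightarrow> nat"
  assumes "\<And>x. p x < k" "\<And>y. q y < k" "unit_valued a" "\<And>x y. f x y = a (p x) (q y)"
  shows "step_fun k f"
  unfolding step_fun_def using assms
  by (intro exI[where x = p] exI[where x = q] exI[where x = a]) (auto simp: fun_eq_iff)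

lemma step_fun_unit_valued: "step_fun k f \<Longrightarrow> unit_valued f"
  by (auto simp: step_fun_def unit_valued_def)

lemma step_fun_mono:
  assumes "step_fun k f" "k \<le> l" shows "step_fun l f"
proof -
  obtain p q a where "\<forall>x. p x < k" "\<forall>y. q y < k" "unit_valued a" "f = (\<lambda>x y. a (p x) (q y))"
    using assms(1) unfolding step_fun_def by metis
  then show ?thesis
    unfolding step_fun_def using assms(2) by (metis order_less_le_trans)
qed

lemma step_fun_zero: "1 \<le> k \<Longrightarrow> step_fun k (\<lambda>x y. 0)"
  unfolding step_fun_def unit_valued_def
  by (intro exI[of _ "\<lambda>_. 0"] exI[of _ "\<lambda>_ _. 0"]) auto

lemma mixed_radix_less:
  fixes i j k l :: nat
  assumes "i < k" "j < l" shows "i * l + j < k * l"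
proof -
  have "i * l + j < Suc i * l" using assms by simp
  also have "\<dots> \<le> k * l" using assms by (intro mult_right_mono) auto
  finally show ?thesis .
qed

lemma mixed_radix_div:
  fixes i j l :: nat
  shows "j < l \<Longrightarrow> (i * l + j) div l = i"
  by simp

text \<open>The label \<open>i * l + j\<close> stores the pair (i, j), so \<open>k * l\<close>
  labels describe the common refinement on each side. Midpoints are needed for the parallelogram
  identity.\<close>

lemma step_fun_average:
  assumes "step_fun k f" "step_fun l g"
  shows "step_fun (k * l) (\<lambda>x y. (f x y + g x y) / 2)"
proof -
  obtain p q a where f: "\<forall>x. p x < k" "\<forall>y. q y < k" "unit_valued a" "f = (\<lambda>x y. a (p x) (q y))"
    using assms(1) unfolding step_fun_def by metis
  obtain p' q' b where g: "\<forall>x. p' x < l" "\<forall>y. q' y < l" "unit_valued b"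
    "g = (\<lambda>x y. b (p' x) (q' y))"
    using assms(2) unfolding step_fun_def by metis
  define c where "c i j = (a (i div l) (j div l) + b (i mod l) (j mod l)) / 2" for i j
  have "unit_valued c"
    unfolding unit_valued_def c_def
  proof (intro allI conjI)
    fix i j
    have "0 \<le> a (i div l) (j div l)" "a (i div l) (j div l) \<le> 1"
      "0 \<le> b (i mod l) (j mod l)" "b (i mod l) (j mod l) \<le> 1"
      using f(3) g(3) unfolding unit_valued_def by auto
    then show "0 \<le> (a (i div l) (j div l) + b (i mod l) (j mod l)) / 2"
      "(a (i div l) (j div l) + b (i mod l) (j mod l)) / 2 \<le> 1" by auto
  qed
  moreover have "(f x y + g x y) / 2 = c (p x * l + p' x) (q y * l + q' y)" for x y
    using f g by (simp add: c_def mixed_radix_div)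
  moreover have "p x * l + p' x < k * l" "q x * l + q' x < k * l" for x
    using f g by (auto intro!: mixed_radix_less)
  ultimately show ?thesis
    by (intro step_funI[where p = "\<lambda>x. p x * l + p' x" and q = "\<lambda>y. q y * l + q' y" and a = c])
qed

text \<open>The last binary digit of the new label records membership in \<open>U\<close> or
  \<open>W\<close>. Clamping restores values in [0, 1] after the correction.\<close>

lemma step_fun_clamp_add_rectangle:
  assumes "step_fun k f"
  shows "step_fun (k * 2) (\<lambda>x y. max 0 (min 1 (f x y + c * (of_bool (x \<in> U) * of_bool (y \<in> W)))))"
proof -
  obtain p q a where f: "\<forall>x. p x < k" "\<forall>y. q y < k" "unit_valued a" "f = (\<lambda>x y. a (p x) (q y))"
    using assms(1) unfolding step_fun_def by metis
  define b where "b i j = max 0 (min 1 (a (i div 2) (j div 2) + c * (of_bool (odd i) * of_bool (odd j))))"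
    for i j :: nat
  have "unit_valued b"
    unfolding unit_valued_def b_def by auto
  moreover have "(i * 2 + of_bool P) div 2 = i" "odd (i * 2 + of_bool P) = P" for i :: nat and P
    by (cases P; auto)+
  then have "max 0 (min 1 (f x y + c * (of_bool (x \<in> U) * of_bool (y \<in> W)))) =
      b (p x * 2 + of_bool (x \<in> U)) (q y * 2 + of_bool (y \<in> W))" for x y
    unfolding b_def f by presburger
  moreover have "p x * 2 + of_bool (x \<in> U) < k * 2" "q x * 2 + of_bool (x \<in> W) < k * 2" for x
    using f(1,2) by (intro mixed_radix_less; simp)+
  ultimately show ?thesis
    by (intro step_funI[where p = "\<lambda>x. p x * 2 + of_bool (x \<in> U)"
          and q = "\<lambda>y. q y * 2 + of_bool (y \<in> W)" and a = b])
qed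

text \<open>The drops telescope to at most \<open>B\<close>, so not all \<open>N\<close> of them can
  exceed \<open>\<beta>\<close>.\<close>

lemma bounded_decreasing_pigeonhole:
  fixes D :: "nat \<Rightarrow> real"
  assumes "\<And>n. 0 \<le> D n" "D 0 \<le> B" "B < real N * \<beta>"
  shows "\<exists>n<N. D n - D (Suc n) \<le> \<beta>"
proof (rule ccontr)
  assume "\<not> ?thesis"
  then have "real N * \<beta> \<le> (\<Sum>n<N. D n - D (Suc n))"
    using sum_mono[of "{..<N}" "\<lambda>_. \<beta>" "\<lambda>n. D n - D (Suc n)"] by force
  also have "\<dots> = D 0 - D N"
    by (rule sum_lessThan_telescope')
  finally show False using assms(1)[of N] assms(2,3) by linarith
qed

section \<open>Weighted averages and the distance to step functions\<close>

locale weighted_set =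
  fixes V :: "'b set" and w :: "'b \<Rightarrow> real"
  assumes fin: "finite V"
    and w_nonneg: "\<And>x. x \<in> V \<Longrightarrow> 0 \<le> w x"
    and w_sum: "(\<Sum>x\<in>V. w x) = 1"
begin

definition avg :: "('b \<Rightarrow> 'b \<Rightarrow> real) \<Rightarrow> real" where
  "avg f = (\<Sum>x\<in>V. \<Sum>y\<in>V. w x * w y * f x y)"

lemma avg_mono:
  assumes "\<And>x y. f x y \<le> g x y" shows "avg f \<le> avg g"
  unfolding avg_def by (intro sum_mono mult_left_mono mult_nonneg_nonneg w_nonneg assms)

lemma avg_add: "avg (\<lambda>x y. f x y + g x y) = avg f + avg g"
  by (simp add: avg_def sum.distrib algebra_simps)

lemma avg_diff: "avg (\<lambda>x y. f x y - g x y) = avg f - avg g"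
  by (simp add: avg_def sum_subtractf algebra_simps)

lemma avg_cmult: "avg (\<lambda>x y. c * f x y) = c * avg f"
  by (simp add: avg_def sum_distrib_left algebra_simps)

lemma avg_uminus: "avg (\<lambda>x y. - f x y) = - avg f"
  by (simp add: avg_def sum_negf)

lemma avg_const: "avg (\<lambda>x y. c) = c"
proof -
  have "avg (\<lambda>x y. c) = (\<Sum>x\<in>V. w x * (c * (\<Sum>y\<in>V. w y)))"
    by (simp add: avg_def sum_distrib_left algebra_simps)
  then show ?thesis by (simp add: w_sum sum_distrib_right[symmetric])
qed

lemma avg_nonneg: "(\<And>x y. 0 \<le> f x y) \<Longrightarrow> 0 \<le> avg f"
  using avg_mono[of "\<lambda>_ _. 0" f] by (simp add: avg_const)

lemma avg_swap: "avg (\<lambda>x y. f y x) = avg f"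
  unfolding avg_def by (subst sum.swap) (simp add: mult.commute)

lemma avg_sum: "avg (\<lambda>x y. \<Sum>i\<in>I. f i x y) = (\<Sum>i\<in>I. avg (f i))"
proof -
  have "avg (\<lambda>x y. \<Sum>i\<in>I. f i x y) = (\<Sum>x\<in>V. \<Sum>y\<in>V. \<Sum>i\<in>I. w x * w y * f i x y)"
    by (simp add: avg_def sum_distrib_left)
  also have "\<dots> = (\<Sum>x\<in>V. \<Sum>i\<in>I. \<Sum>y\<in>V. w x * w y * f i x y)"
    by (intro sum.cong refl sum.swap)
  also have "\<dots> = (\<Sum>i\<in>I. avg (f i))"
    unfolding avg_def by (rule sum.swap)
  finally show ?thesis .
qed

definition sqnorm :: "('b \<Rightarrow> 'b \<Rightarrow> real) \<Rightarrow> real" where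
  "sqnorm f = avg (\<lambda>x y. (f x y)\<^sup>2)"

text \<open>The potential of the energy increment argument: for \<open>k \<ge> 1\<close> and
  unit-valued \<open>A\<close> it lies in [0, 1] and is nonincreasing in \<open>k\<close>, so it is
  nearly stationary at some scale.\<close>

definition sqdist :: "nat \<Rightarrow> ('b \<Rightarrow> 'b \<Rightarrow> real) \<Rightarrow> real" where
  "sqdist k A = (INF f\<in>{f. step_fun k f}. sqnorm (\<lambda>x y. A x y - f x y))"

lemma sqnorm_nonneg: "0 \<le> sqnorm f"
  unfolding sqnorm_def by (rule avg_nonneg) simp

lemma sqdist_le: "step_fun k f \<Longrightarrow> sqdist k A \<le> sqnorm (\<lambda>x y. A x y - f x y)"
  unfolding sqdist_def by (rule cINF_lower) (auto intro!: bdd_belowI[of _ 0] sqnorm_nonneg)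

lemma sqdist_nonneg: "1 \<le> k \<Longrightarrow> 0 \<le> sqdist k A"
  unfolding sqdist_def using step_fun_zero[of k]
  by (intro cINF_greatest) (auto intro!: sqnorm_nonneg)

lemma sqdist_le_1:
  assumes "1 \<le> k" "unit_valued A" shows "sqdist k A \<le> 1"
proof -
  have "sqdist k A \<le> sqnorm (\<lambda>x y. A x y - 0)"
    by (rule sqdist_le[OF step_fun_zero[OF assms(1)]])
  also have "\<dots> \<le> avg (\<lambda>x y. 1)"
    unfolding sqnorm_def using assms(2)
    by (intro avg_mono) (auto simp: unit_valued_def power_le_one)
  finally show ?thesis by (simp add: avg_const)
qed

lemma sqdist_antimono:
  assumes "1 \<le> k" "k \<le> l" shows "sqdist l A \<le> sqdist k A"
  unfolding sqdist_def[of k]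
  by (rule cINF_greatest)
     (use assms step_fun_zero[of k] in \<open>auto intro!: sqdist_le step_fun_mono[of k _ l]\<close>)

lemma near_minimiser:
  assumes "1 \<le> k" "0 < \<beta>"
  obtains f where "step_fun k f" "sqnorm (\<lambda>x y. A x y - f x y) \<le> sqdist k A + \<beta>"
proof -
  have "\<exists>f\<in>{f. step_fun k f}. sqnorm (\<lambda>x y. A x y - f x y) < sqdist k A + \<beta>"
    using assms step_fun_zero[of k] unfolding sqdist_def
    by (subst cINF_less_iff[symmetric]) (auto intro!: bdd_belowI[of _ 0] sqnorm_nonneg)
  then show thesis using that by (auto intro: less_imp_le)
qed

text \<open>
  Adding the multiple of a rectangle indicator suggested by the correlation \<open>s\<close> would improve the
  approximation by \<open>s\<^sup>2\<close>.
\<close>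

lemma near_minimiser_cut:
  assumes "unit_valued A" "step_fun k g" "1 \<le> k"
    and near: "sqnorm (\<lambda>x y. A x y - g x y) \<le> sqdist k A + \<beta>"
    and drop: "sqdist k A - sqdist (k * 2) A \<le> \<beta>"
  shows "(avg (\<lambda>x y. (A x y - g x y) * (of_bool (x \<in> U) * of_bool (y \<in> W))))\<^sup>2 \<le> 2 * \<beta>"
proof -
  let ?r = "\<lambda>x y. of_bool (x \<in> U) * of_bool (y \<in> W) :: real"
  define s where "s = avg (\<lambda>x y. (A x y - g x y) * ?r x y)"
  define g' where "g' x y = max 0 (min 1 (g x y + s * ?r x y))" for x y
  have "sqdist (k * 2) A \<le> sqnorm (\<lambda>x y. A x y - g' x y)"
    unfolding g'_def by (rule sqdist_le[OF step_fun_clamp_add_rectangle[OF assms(2)]])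
  also have "\<dots> \<le> avg (\<lambda>x y. ((A x y - g x y)\<^sup>2 + (- 2 * s) * ((A x y - g x y) * ?r x y)) + s\<^sup>2)"
    unfolding sqnorm_def
  proof (rule avg_mono)
    fix x y
    have A: "0 \<le> A x y" "A x y \<le> 1" using assms(1) by (auto simp: unit_valued_def)
    \<comment> \<open>\<open>A x y\<close> lies in [0, 1], so clamping the other value to [0, 1]
      cannot move it away from \<open>A x y\<close>.\<close>
    have "\<bar>A x y - g' x y\<bar> \<le> \<bar>A x y - (g x y + s * ?r x y)\<bar>"
      unfolding g'_def using A by linarith
    then have "(A x y - g' x y)\<^sup>2 \<le> (A x y - (g x y + s * ?r x y))\<^sup>2"
      by (simp only: abs_le_square_iff)
    also have "\<dots> = (A x y - g x y)\<^sup>2 + (- 2 * s) * ((A x y - g x y) * ?r x y) + s\<^sup>2 * (?r x y)\<^sup>2"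
      by (simp add: power2_eq_square algebra_simps)
    also have "\<dots> \<le> (A x y - g x y)\<^sup>2 + (- 2 * s) * ((A x y - g x y) * ?r x y) + s\<^sup>2"
      by (auto simp: of_bool_def)
    finally show "(A x y - g' x y)\<^sup>2 \<le> (A x y - g x y)\<^sup>2 + (- 2 * s) * ((A x y - g x y) * ?r x y) + s\<^sup>2" .
  qed
  also have "\<dots> = sqnorm (\<lambda>x y. A x y - g x y) - s\<^sup>2"
    unfolding avg_add avg_cmult avg_const s_def[symmetric] sqnorm_def by (simp add: power2_eq_square)
  finally show ?thesis using near drop unfolding s_def by linarith
qed

text \<open>By the parallelogram identity the midpoint of \<open>f\<close> and \<open>g\<close>
  improves on the mean of their errors by a quarter of their squared distance. The midpoint has
  \<open>k * l\<close> labels, so this gain is at most \<open>2 * \<beta>\<close>: one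
  \<open>\<beta>\<close> from near minimality and one from the assumed drop.\<close>

lemma near_minimisers_close:
  assumes "step_fun k f" "step_fun l g" "1 \<le> k" "k \<le> l"
    and f: "sqnorm (\<lambda>x y. A x y - f x y) \<le> sqdist k A + \<beta>"
    and g: "sqnorm (\<lambda>x y. A x y - g x y) \<le> sqdist l A + \<beta>"
    and drop: "sqdist k A - sqdist (k * l) A \<le> \<beta>"
  shows "sqnorm (\<lambda>x y. f x y - g x y) \<le> 8 * \<beta>"
proof -
  have "sqdist (k * l) A \<le> sqnorm (\<lambda>x y. A x y - (f x y + g x y) / 2)"
    by (rule sqdist_le[OF step_fun_average[OF assms(1,2)]])
  also have "(\<lambda>x y. (A x y - (f x y + g x y) / 2)\<^sup>2) =
      (\<lambda>x y. 1/2 * (A x y - f x y)\<^sup>2 + 1/2 * (A x y - g x y)\<^sup>2 - 1/4 * (f x y - g x y)\<^sup>2)"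
    by (intro ext) (simp add: power2_eq_square field_simps)
  then have "sqnorm (\<lambda>x y. A x y - (f x y + g x y) / 2) =
      1/2 * sqnorm (\<lambda>x y. A x y - f x y) + 1/2 * sqnorm (\<lambda>x y. A x y - g x y)
        - 1/4 * sqnorm (\<lambda>x y. f x y - g x y)"
    unfolding sqnorm_def by (simp only: avg_add avg_diff avg_cmult)
  finally show ?thesis
    using f g drop sqdist_antimono[OF assms(3,4), of A] by linarith
qed

text \<open>A pointwise arithmetic-geometric mean inequality does the work of
  Cauchy-Schwarz.\<close>

lemma avg_abs_le:
  assumes "sqnorm h \<le> c\<^sup>2" "0 < c" shows "avg (\<lambda>x y. \<bar>h x y\<bar>) \<le> c"
proof -
  have "avg (\<lambda>x y. \<bar>h x y\<bar>) \<le> avg (\<lambda>x y. 1 / (2 * c) * (h x y)\<^sup>2 + c / 2)"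
  proof (rule avg_mono)
    fix x y
    have "0 \<le> (\<bar>h x y\<bar> - c)\<^sup>2" by simp
    also have "\<dots> = (h x y)\<^sup>2 - 2 * c * \<bar>h x y\<bar> + c\<^sup>2" by (simp add: power2_eq_square algebra_simps)
    finally show "\<bar>h x y\<bar> \<le> 1 / (2 * c) * (h x y)\<^sup>2 + c / 2"
      using assms(2) by (simp add: field_simps power2_eq_square)
  qed
  also have "\<dots> = 1 / (2 * c) * sqnorm h + c / 2"
    unfolding avg_add avg_cmult avg_const sqnorm_def ..
  also have "\<dots> \<le> 1 / (2 * c) * c\<^sup>2 + c / 2"
    using assms by (intro add_right_mono mult_left_mono) auto
  finally show ?thesis using assms(2) by (simp add: power2_eq_square)
qed

text \<open>The average is linear in each value \<open>u x\<close>, so it is largest at an extreme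
  point: 1 where the coefficient \<open>H x\<close> is positive and 0 elsewhere.\<close>

lemma avg_le_avg_set:
  assumes "\<And>x. 0 \<le> u x \<and> u x \<le> 1"
  shows "\<exists>U. avg (\<lambda>x y. h x y * (u x * v y)) \<le> avg (\<lambda>x y. h x y * (of_bool (x \<in> U) * v y))"
proof -
  define H where "H x = (\<Sum>y\<in>V. w y * (h x y * v y))" for x
  have *: "avg (\<lambda>x y. h x y * (u x * v y)) = (\<Sum>x\<in>V. w x * (u x * H x))" for u
    unfolding avg_def H_def by (simp add: sum_distrib_left mult_ac)
  have "u x * H x \<le> of_bool (x \<in> {x. 0 < H x}) * H x" for x
    using assms[of x] by (auto simp: mult_left_le_one_le mult_nonneg_nonpos)
  then have "avg (\<lambda>x y. h x y * (u x * v y)) \<le> avg (\<lambda>x y. h x y * (of_bool (x \<in> {x. 0 < H x}) * v y))"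
    unfolding * by (intro sum_mono mult_left_mono w_nonneg) auto
  then show ?thesis by blast
qed

lemma avg_le_cut:
  assumes cut: "\<And>U W. avg (\<lambda>x y. h x y * (of_bool (x \<in> U) * of_bool (y \<in> W))) \<le> \<eta>"
    and "\<And>x. 0 \<le> u x \<and> u x \<le> 1" "\<And>x. 0 \<le> v x \<and> v x \<le> 1"
  shows "avg (\<lambda>x y. h x y * (u x * v y)) \<le> \<eta>"
proof -
  obtain U where U: "avg (\<lambda>x y. h x y * (u x * v y)) \<le> avg (\<lambda>x y. h x y * (of_bool (x \<in> U) * v y))"
    using avg_le_avg_set[of u h v] assms(2) by blast
  also have "\<dots> = avg (\<lambda>y x. h x y * (v y * of_bool (x \<in> U)))"
    by (subst avg_swap[symmetric]) (simp add: mult_ac)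
  also obtain W where "avg (\<lambda>y x. h x y * (v y * of_bool (x \<in> U)))
      \<le> avg (\<lambda>y x. h x y * (of_bool (y \<in> W) * of_bool (x \<in> U)))"
    using avg_le_avg_set[of v "\<lambda>y x. h x y" "\<lambda>x. of_bool (x \<in> U)"] assms(3) by blast
  also have "avg (\<lambda>y x. h x y * (of_bool (y \<in> W) * of_bool (x \<in> U)))
      = avg (\<lambda>x y. h x y * (of_bool (x \<in> U) * of_bool (y \<in> W)))"
    by (subst avg_swap[symmetric]) (simp add: mult_ac)
  finally show ?thesis using cut[of U W] by linarith
qed

section \<open>Cut norm and the counting lemma\<close>

definition triangles ::
  "('b \<Rightarrow> 'b \<Rightarrow> real) \<Rightarrow> ('b \<Rightarrow> 'b \<Rightarrow> real) \<Rightarrow> ('b \<Rightarrow> 'b \<Rightarrow> real) \<Rightarrow> real" where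
  "triangles A B C = (\<Sum>x\<in>V. \<Sum>y\<in>V. \<Sum>z\<in>V. w x * w y * w z * (A x y * B y z * C x z))"

text \<open>A bound on the cut norm of \<open>h\<close> with respect to the product weight.\<close>

definition cut_bound :: "('b \<Rightarrow> 'b \<Rightarrow> real) \<Rightarrow> real \<Rightarrow> bool" where
  "cut_bound h \<eta> \<longleftrightarrow>
     (\<forall>U W. \<bar>avg (\<lambda>x y. h x y * (of_bool (x \<in> U) * of_bool (y \<in> W)))\<bar> \<le> \<eta>)"

lemma cut_bound_avg:
  assumes "cut_bound h \<eta>" "\<And>x. 0 \<le> u x \<and> u x \<le> 1" "\<And>x. 0 \<le> v x \<and> v x \<le> 1"
  shows "- \<eta> \<le> avg (\<lambda>x y. h x y * (u x * v y))"
proof -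
  have "avg (\<lambda>x y. - h x y * (u x * v y)) \<le> \<eta>"
  proof (rule avg_le_cut)
    fix U W
    have "\<bar>avg (\<lambda>x y. h x y * (of_bool (x \<in> U) * of_bool (y \<in> W)))\<bar> \<le> \<eta>"
      using assms(1) unfolding cut_bound_def by blast
    then show "avg (\<lambda>x y. - h x y * (of_bool (x \<in> U) * of_bool (y \<in> W))) \<le> \<eta>"
      by (simp add: avg_uminus)
  qed (use assms in auto)
  then show ?thesis by (simp add: avg_uminus)
qed

lemma sum_w_ge: "(\<And>z. z \<in> V \<Longrightarrow> c \<le> f z) \<Longrightarrow> c \<le> (\<Sum>z\<in>V. w z * f z)"
proof -
  assume "\<And>z. z \<in> V \<Longrightarrow> c \<le> f z"
  then have "(\<Sum>z\<in>V. w z * c) \<le> (\<Sum>z\<in>V. w z * f z)"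
    by (intro sum_mono mult_left_mono w_nonneg)
  then show ?thesis by (simp add: sum_distrib_right[symmetric] w_sum)
qed

text \<open>The three graphs are replaced one at a time. With the vertex opposite to the replaced
  edge frozen, each of the other two factors depends on one endpoint of that edge, so the cut bound
  with [0, 1]-valued weights applies.\<close>

lemma triangles_counting:
  assumes unit: "unit_valued A" "unit_valued B" "unit_valued C"
      "unit_valued A'" "unit_valued B'" "unit_valued C'"
    and cut: "cut_bound (\<lambda>x y. A x y - A' x y) \<eta>" "cut_bound (\<lambda>x y. B x y - B' x y) \<eta>"
      "cut_bound (\<lambda>x y. C x y - C' x y) \<eta>"
  shows "triangles A' B' C' - 3 * \<eta> \<le> triangles A B C"
proof -
  note [simp] = unit[unfolded unit_valued_def, rule_format]
  have 1: "- \<eta> \<le> triangles (\<lambda>x y. A x y - A' x y) B C"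
  proof -
    have "triangles h B C = (\<Sum>x\<in>V. \<Sum>z\<in>V. \<Sum>y\<in>V. w x * w y * w z * (h x y * B y z * C x z))" for h
      unfolding triangles_def by (intro sum.cong refl sum.swap)
    also have "\<dots> h = (\<Sum>z\<in>V. \<Sum>x\<in>V. \<Sum>y\<in>V. w x * w y * w z * (h x y * B y z * C x z))" for h
      by (rule sum.swap)
    also have "\<dots> h = (\<Sum>z\<in>V. w z * avg (\<lambda>x y. h x y * (C x z * B y z)))" for h
      by (simp add: avg_def sum_distrib_left mult_ac)
    finally have "triangles h B C = (\<Sum>z\<in>V. w z * avg (\<lambda>x y. h x y * (C x z * B y z)))" for h .
    then show ?thesis by (auto intro!: sum_w_ge cut_bound_avg cut)
  qed
  have 2: "- \<eta> \<le> triangles A' (\<lambda>x y. B x y - B' x y) C"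
  proof -
    have "triangles A' h C = (\<Sum>x\<in>V. w x * avg (\<lambda>y z. h y z * (A' x y * C x z)))" for h
      by (simp add: triangles_def avg_def sum_distrib_left mult_ac)
    then show ?thesis by (auto intro!: sum_w_ge cut_bound_avg cut)
  qed
  have 3: "- \<eta> \<le> triangles A' B' (\<lambda>x y. C x y - C' x y)"
  proof -
    have "triangles A' B' h = (\<Sum>y\<in>V. \<Sum>x\<in>V. \<Sum>z\<in>V. w x * w y * w z * (A' x y * B' y z * h x z))" for h
      unfolding triangles_def by (rule sum.swap)
    also have "\<dots> h = (\<Sum>y\<in>V. w y * avg (\<lambda>x z. h x z * (A' x y * B' y z)))" for h
      by (simp add: avg_def sum_distrib_left mult_ac)
    finally have "triangles A' B' h = (\<Sum>y\<in>V. w y * avg (\<lambda>x z. h x z * (A' x y * B' y z)))" for h .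
    then show ?thesis by (auto intro!: sum_w_ge cut_bound_avg cut)
  qed
  have "triangles A B C - triangles A' B' C' = triangles (\<lambda>x y. A x y - A' x y) B C +
      triangles A' (\<lambda>x y. B x y - B' x y) C + triangles A' B' (\<lambda>x y. C x y - C' x y)"
    unfolding triangles_def sum_subtractf[symmetric] sum.distrib[symmetric]
    by (intro sum.cong refl) (simp add: algebra_simps)
  then show ?thesis using 1 2 3 by linarith
qed

section \<open>Strong regularity\<close>

text \<open>The coarse function \<open>f\<close> has bounded complexity; the finer \<open>g\<close>
  is what \<open>A\<close> resembles in cut norm. Having both allows \<open>e\<close> to be tiny
  compared with \<open>1 / k\<close> while the L1 error \<open>c\<close> stays fixed.\<close>

definition structured ::
  "real \<Rightarrow> real \<Rightarrow> nat \<Rightarrow> ('b \<Rightarrow> 'b \<Rightarrow> real) \<Rightarrow> ('b \<Rightarrow> 'b \<Rightarrow> real) \<Rightarrow> ('b \<Rightarrow> 'b \<Rightarrow> real) \<Rightarrow> bool" where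
  "structured c e k A f g \<longleftrightarrow> step_fun k f \<and> unit_valued g \<and>
     avg (\<lambda>x y. \<bar>g x y - f x y\<bar>) \<le> c \<and> cut_bound (\<lambda>x y. A x y - g x y) e"

text \<open>\<open>f\<close> and \<open>g\<close> are near-minimisers at the scales
  \<open>k \<le> l\<close>. Near-stationarity from \<open>k\<close> to \<open>k * l\<close> makes
  them close; near-stationarity from \<open>l\<close> to \<open>l * 2\<close> leaves no rectangle
  correlated with \<open>A - g\<close>.\<close>

lemma structured_exists:
  assumes "unit_valued A" "1 \<le> k" "k \<le> l" "0 < c" "0 < e"
    and coarse: "sqdist k A - sqdist (k * l) A \<le> c\<^sup>2 / 8"
    and fine: "sqdist l A - sqdist (l * 2) A \<le> e\<^sup>2 / 2"
  shows "\<exists>f g. structured c e k A f g"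
proof -
  \<comment> \<open>The two terms give squared L2 distance
    \<open>8 * (c\<^sup>2 / 8) = c\<^sup>2\<close> and squared rectangle correlation
    \<open>2 * (e\<^sup>2 / 2) = e\<^sup>2\<close>.\<close>
  define \<beta> where "\<beta> = min (c\<^sup>2 / 8) (e\<^sup>2 / 2)"
  have \<beta>: "0 < \<beta>" "\<beta> \<le> c\<^sup>2 / 8" "\<beta> \<le> e\<^sup>2 / 2" using assms(4,5) by (auto simp: \<beta>_def)
  have l: "1 \<le> l" using assms by linarith
  obtain f where f: "step_fun k f" "sqnorm (\<lambda>x y. A x y - f x y) \<le> sqdist k A + \<beta>"
    by (rule near_minimiser[OF assms(2) \<beta>(1)])
  obtain g where g: "step_fun l g" "sqnorm (\<lambda>x y. A x y - g x y) \<le> sqdist l A + \<beta>"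
    by (rule near_minimiser[OF l \<beta>(1)])
  have "sqnorm (\<lambda>x y. f x y - g x y) \<le> 8 * (c\<^sup>2 / 8)"
    by (rule near_minimisers_close[OF f(1) g(1) assms(2,3)]) (use f g \<beta> coarse in auto)
  then have "avg (\<lambda>x y. \<bar>f x y - g x y\<bar>) \<le> c"
    by (intro avg_abs_le assms) simp
  moreover have "cut_bound (\<lambda>x y. A x y - g x y) e"
    unfolding cut_bound_def
  proof (intro allI)
    fix U W
    have "(avg (\<lambda>x y. (A x y - g x y) * (of_bool (x \<in> U) * of_bool (y \<in> W))))\<^sup>2 \<le> 2 * (e\<^sup>2 / 2)"
      by (rule near_minimiser_cut[OF assms(1) g(1) l]) (use g \<beta> fine in auto)
    then show "\<bar>avg (\<lambda>x y. (A x y - g x y) * (of_bool (x \<in> U) * of_bool (y \<in> W)))\<bar> \<le> e"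
      using assms(5) by (auto intro: power2_le_imp_le[of _ e])
  qed
  ultimately have "structured c e k A f g"
    using f g unfolding structured_def by (simp add: step_fun_unit_valued abs_minus_commute)
  then show ?thesis by blast
qed

text \<open>On the region \<open>f < t\<close> the parts \<open>f\<close>, \<open>g - f\<close> and
  \<open>A - g\<close> contribute at most \<open>t\<close>, \<open>c\<close> and
  \<open>(real k)\<^sup>2 * e\<close>: the region is a union of at most k^2 label rectangles, each
  of which costs one cut error.\<close>

lemma structured_low_mass:
  assumes "structured c e k A f g" "unit_valued A" "0 \<le> t" "0 \<le> e"
  shows "avg (\<lambda>x y. A x y * of_bool (f x y < t)) \<le> t + c + (real k)\<^sup>2 * e"
proof -
  obtain p q a where f: "\<forall>x. p x < k" "\<forall>y. q y < k" "unit_valued a" "f = (\<lambda>x y. a (p x) (q y))"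
    using assms(1) unfolding step_fun_def structured_def by metis
  let ?h = "\<lambda>x y. A x y - g x y"
  have "avg (\<lambda>x y. A x y * of_bool (f x y < t)) \<le>
      avg (\<lambda>x y. (t + \<bar>g x y - f x y\<bar>) + ?h x y * of_bool (f x y < t))"
    using assms(3) by (intro avg_mono) (auto simp: of_bool_def)
  also have "\<dots> = t + avg (\<lambda>x y. \<bar>g x y - f x y\<bar>) + avg (\<lambda>x y. ?h x y * of_bool (f x y < t))"
    unfolding avg_add avg_const ..
  \<comment> \<open>Only the pair (i, j) of labels of \<open>x\<close> and \<open>y\<close> survives
    in the double sum.\<close>
  also have "(\<lambda>x y. ?h x y * of_bool (f x y < t)) = (\<lambda>x y. \<Sum>i<k. \<Sum>j<k.
      of_bool (a i j < t) * (?h x y * (of_bool (x \<in> {x. p x = i}) * of_bool (y \<in> {y. q y = j}))))"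
    (is "_ = ?R")
  proof (intro ext)
    fix x y
    have "?R x y = (\<Sum>i<k. if i = p x then of_bool (a i (q y) < t) * ?h x y else 0)"
    proof (intro sum.cong refl)
      fix i
      have "(\<Sum>j<k. of_bool (a i j < t) * (?h x y * (of_bool (x \<in> {x. p x = i}) * of_bool (y \<in> {y. q y = j}))))
        = (\<Sum>j<k. if j = q y then of_bool (a i j < t) * (?h x y * of_bool (p x = i)) else 0)"
        by (intro sum.cong) auto
      also have "\<dots> = of_bool (a i (q y) < t) * (?h x y * of_bool (p x = i))"
        using f(2) by (subst sum.delta) auto
      finally show "(\<Sum>j<k. of_bool (a i j < t) * (?h x y * (of_bool (x \<in> {x. p x = i}) * of_bool (y \<in> {y. q y = j}))))
        = (if i = p x then of_bool (a i (q y) < t) * ?h x y else 0)" by auto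
    qed
    also have "\<dots> = of_bool (a (p x) (q y) < t) * ?h x y"
      using f(1) by (subst sum.delta) auto
    finally show "?h x y * of_bool (f x y < t) = ?R x y" by (simp add: f(4))
  qed
  also have "avg \<dots> = (\<Sum>i<k. \<Sum>j<k. of_bool (a i j < t) *
      avg (\<lambda>x y. ?h x y * (of_bool (x \<in> {x. p x = i}) * of_bool (y \<in> {y. q y = j}))))"
    by (simp only: avg_sum avg_cmult)
  also have "\<dots> \<le> (\<Sum>i<k. \<Sum>j<k. e)"
  proof (intro sum_mono)
    fix i j
    let ?s = "avg (\<lambda>x y. ?h x y * (of_bool (x \<in> {x. p x = i}) * of_bool (y \<in> {y. q y = j})))"
    have "\<bar>?s\<bar> \<le> e"
      using assms(1) unfolding structured_def cut_bound_def by blast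
    then show "of_bool (a i j < t) * ?s \<le> e"
      using assms(4) by (cases "a i j < t") (simp_all del: mem_Collect_eq)
  qed
  also have "\<dots> = (real k)\<^sup>2 * e" by (simp add: power2_eq_square)
  finally show ?thesis using assms(1) unfolding structured_def by linarith
qed

end

text \<open>Two nested pigeonholes. The outer one picks a scale \<open>k\<close> with little drop up
  to the next outer scale; the inner one picks \<open>l\<close> among the doublings of
  \<open>k\<close> so that one further doubling gains little. Running both on the sum of the three
  distances gives one \<open>k\<close> for all three functions, and \<open>K\<close> depends only on
  \<open>c\<close> and \<open>\<eta>\<close>.\<close>

lemma regularity:
  fixes \<eta> :: "nat \<Rightarrow> real"
  assumes "0 < c" and \<eta>: "\<And>k. 1 \<le> k \<Longrightarrow> 0 < \<eta> k"
  obtains K where "\<And>(V :: 'b set) w A B C.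
    weighted_set V w \<Longrightarrow> unit_valued A \<Longrightarrow> unit_valued B \<Longrightarrow> unit_valued C \<Longrightarrow>
    \<exists>k f f' f'' g g' g''. 1 \<le> k \<and> k \<le> K \<and> weighted_set.structured V w c (\<eta> k) k A f g \<and>
      weighted_set.structured V w c (\<eta> k) k B f' g' \<and> weighted_set.structured V w c (\<eta> k) k C f'' g''"
proof -
  \<comment> \<open>The 3 bounds the sum of three distances, each at most 1.\<close>
  have "\<exists>N. 3 < real N * ((\<eta> k)\<^sup>2 / 2)" if "1 \<le> k" for k
    using \<eta>[OF that] by (intro ex_less_of_nat_mult) simp
  then obtain J where J: "\<And>k. 1 \<le> k \<Longrightarrow> 3 < real (J k) * ((\<eta> k)\<^sup>2 / 2)" by metis
  obtain N where N: "3 < real N * (c\<^sup>2 / 8)"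
    using ex_less_of_nat_mult[of "c\<^sup>2 / 8" 3] assms(1) by auto
  \<comment> \<open>The factor \<open>k * 2 ^ J k\<close> exceeds every \<open>l = k * 2 ^ j\<close>
    of the inner search; the additional factor \<open>k\<close> makes the next outer scale exceed
    \<open>k * l\<close>.\<close>
  define s where "s = rec_nat 1 (\<lambda>_ k. k * (k * 2 ^ J k) :: nat)"
  have s_Suc: "s (Suc n) = s n * (s n * 2 ^ J (s n))" for n by (simp add: s_def)
  have s_ge: "1 \<le> s n" for n
  proof (induction n)
    case (Suc n) then show ?case unfolding s_Suc by simp
  qed (simp add: s_def)
  have s_le_Suc: "s n \<le> s (Suc n)" for n
    unfolding s_Suc using s_ge[of n] by simp
  have s_mono: "s n \<le> s N" if "n \<le> N" for n
    using lift_Suc_mono_le[of s, OF s_le_Suc that] .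
  show thesis
  proof (rule that[of "s N"])
    fix V :: "'b set" and w and A B C :: "'b \<Rightarrow> 'b \<Rightarrow> real"
    assume W: "weighted_set V w" and unit: "unit_valued A" "unit_valued B" "unit_valued C"
    interpret weighted_set V w by (rule W)
    define D where "D k = sqdist k A + sqdist k B + sqdist k C" for k
    have D_ge: "0 \<le> D k" if "1 \<le> k" for k
      unfolding D_def by (intro add_nonneg_nonneg sqdist_nonneg that)
    have D_le: "D k \<le> 3" if "1 \<le> k" for k
      unfolding D_def using sqdist_le_1[OF that unit(1)] sqdist_le_1[OF that unit(2)]
        sqdist_le_1[OF that unit(3)] by linarith
    \<comment> \<open>All three distances are nonincreasing, so the drop of one is bounded by the
      drop of the sum.\<close>
    have drop: "sqdist k A' - sqdist l A' \<le> D k - D l"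
      if "1 \<le> k" "k \<le> l" "A' \<in> {A, B, C}" for k l A'
      unfolding D_def using that sqdist_antimono[OF that(1,2), of A] sqdist_antimono[OF that(1,2), of B]
        sqdist_antimono[OF that(1,2), of C] by auto
    obtain n where n: "n < N" "D (s n) - D (s (Suc n)) \<le> c\<^sup>2 / 8"
      using bounded_decreasing_pigeonhole[of "\<lambda>n. D (s n)" 3 N "c\<^sup>2 / 8"] D_ge D_le s_ge N by blast
    define k where "k = s n"
    have k: "1 \<le> k" unfolding k_def by (rule s_ge)
    have k2: "1 \<le> k * 2 ^ j" for j using k by simp
    obtain j where j: "j < J k" "D (k * 2 ^ j) - D (k * 2 ^ Suc j) \<le> (\<eta> k)\<^sup>2 / 2"
      using bounded_decreasing_pigeonhole[of "\<lambda>j. D (k * 2 ^ j)" 3 "J k" "(\<eta> k)\<^sup>2 / 2"]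
        D_ge[OF k2] D_le[OF k2] J[OF k] by blast
    define l where "l = k * 2 ^ j"
    have kl: "k \<le> l" "1 \<le> l" "k \<le> k * l" "1 \<le> k * l" using k by (auto simp: l_def)
    have "(2::nat) ^ j \<le> 2 ^ J k" using j(1) by (intro power_increasing) auto
    then have "k * l \<le> s (Suc n)"
      unfolding s_Suc l_def k_def[symmetric] by (intro mult_left_mono) auto
    then have "D (s (Suc n)) \<le> D (k * l)"
      unfolding D_def by (intro add_mono sqdist_antimono kl)
    then have coarse: "D k - D (k * l) \<le> c\<^sup>2 / 8" using n(2) unfolding k_def by linarith
    have fine: "D l - D (l * 2) \<le> (\<eta> k)\<^sup>2 / 2" using j(2) by (simp add: l_def mult_ac)
    have "\<exists>f g. structured c (\<eta> k) k A' f g" if "A' \<in> {A, B, C}" for A'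
    proof (rule structured_exists[OF _ k kl(1) assms(1) \<eta>[OF k]])
      show "unit_valued A'" using that unit by auto
      show "sqdist k A' - sqdist (k * l) A' \<le> c\<^sup>2 / 8"
        using drop[OF k kl(3) that] coarse by linarith
      show "sqdist l A' - sqdist (l * 2) A' \<le> (\<eta> k)\<^sup>2 / 2"
        using drop[OF kl(2) _ that, of "l * 2"] fine by linarith
    qed
    then obtain f g f' g' f'' g'' where "structured c (\<eta> k) k A f g"
      "structured c (\<eta> k) k B f' g'" "structured c (\<eta> k) k C f'' g''"
      by (meson insertI1 insertI2)
    moreover have "k \<le> s N" unfolding k_def using n(1) by (intro s_mono) simp
    ultimately show "\<exists>k f f' f'' g g' g''. 1 \<le> k \<and> k \<le> s N \<and> structured c (\<eta> k) k A f g \<and>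
      structured c (\<eta> k) k B f' g' \<and> structured c (\<eta> k) k C f'' g''"
      using k by blast
  qed
qed


section \<open>Couplings with independent pairs\<close>

locale coupling = weighted_set V w for V :: "'b set" and w +
  fixes \<rho> :: "'b \<Rightarrow> 'b \<Rightarrow> 'b \<Rightarrow> real"
  assumes rho_nonneg: "\<And>x y z. x \<in> V \<Longrightarrow> y \<in> V \<Longrightarrow> z \<in> V \<Longrightarrow> 0 \<le> \<rho> x y z"
    and marginal_xy: "\<And>x y. x \<in> V \<Longrightarrow> y \<in> V \<Longrightarrow> (\<Sum>z\<in>V. \<rho> x y z) = w x * w y"
    and marginal_yz: "\<And>y z. y \<in> V \<Longrightarrow> z \<in> V \<Longrightarrow> (\<Sum>x\<in>V. \<rho> x y z) = w y * w z"
    and marginal_xz: "\<And>x z. x \<in> V \<Longrightarrow> z \<in> V \<Longrightarrow> (\<Sum>y\<in>V. \<rho> x y z) = w x * w z"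
begin

definition coupled :: "('b \<Rightarrow> 'b \<Rightarrow> 'b \<Rightarrow> real) \<Rightarrow> real" where
  "coupled h = (\<Sum>x\<in>V. \<Sum>y\<in>V. \<Sum>z\<in>V. \<rho> x y z * h x y z)"

lemma coupled_mono: "(\<And>x y z. h x y z \<le> h' x y z) \<Longrightarrow> coupled h \<le> coupled h'"
  unfolding coupled_def by (intro sum_mono mult_left_mono rho_nonneg)

lemma coupled_add: "coupled (\<lambda>x y z. h x y z + h' x y z) = coupled h + coupled h'"
  by (simp add: coupled_def sum.distrib distrib_left)

lemma coupled_cmult: "coupled (\<lambda>x y z. c * h x y z) = c * coupled h"
  by (simp add: coupled_def sum_distrib_left mult_ac)

lemma coupled_xy: "coupled (\<lambda>x y z. h x y) = avg h"
  unfolding coupled_def avg_def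
  by (intro sum.cong refl) (simp add: sum_distrib_right[symmetric] marginal_xy)

lemma coupled_yz: "coupled (\<lambda>x y z. h y z) = avg h"
proof -
  have "coupled (\<lambda>x y z. h y z) = (\<Sum>y\<in>V. \<Sum>x\<in>V. \<Sum>z\<in>V. \<rho> x y z * h y z)"
    unfolding coupled_def by (rule sum.swap)
  also have "\<dots> = (\<Sum>y\<in>V. \<Sum>z\<in>V. \<Sum>x\<in>V. \<rho> x y z * h y z)"
    by (intro sum.cong refl sum.swap)
  also have "\<dots> = avg h"
    unfolding avg_def by (intro sum.cong refl) (simp add: sum_distrib_right[symmetric] marginal_yz)
  finally show ?thesis .
qed

lemma coupled_xz: "coupled (\<lambda>x y z. h x z) = avg h"
proof -
  have "coupled (\<lambda>x y z. h x z) = (\<Sum>x\<in>V. \<Sum>z\<in>V. \<Sum>y\<in>V. \<rho> x y z * h x z)"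
    unfolding coupled_def by (intro sum.cong refl sum.swap)
  also have "\<dots> = avg h"
    unfolding avg_def by (intro sum.cong refl) (simp add: sum_distrib_right[symmetric] marginal_xz)
  finally show ?thesis .
qed

text \<open>Triangles with an edge of step value below \<open>t\<close> are discarded. Each of these
  three losses depends on two variables, so a pair marginal turns it into a product average bounded
  by \<open>structured_low_mass\<close>; on the remaining triangles the step product is at least
  t^3.\<close>

lemma coupled_step_ge:
  assumes unit: "unit_valued A" "unit_valued B" "unit_valued C"
    and s: "structured c e k A f g" "structured c e k B f' g'" "structured c e k C f'' g''"
    and "0 \<le> t" "0 \<le> e"
  shows "t ^ 3 * (coupled (\<lambda>x y z. A x y * B y z * C x z) - 3 * (t + c + (real k)\<^sup>2 * e))
    \<le> coupled (\<lambda>x y z. f x y * f' y z * f'' x z)"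
proof -
  let ?ind = "\<lambda>x y z. of_bool (t \<le> f x y) * of_bool (t \<le> f' y z) * of_bool (t \<le> f'' x z) :: real"
  define m where "m = t + c + (real k)\<^sup>2 * e"
  have uf: "0 \<le> f x y" "0 \<le> f' x y" "0 \<le> f'' x y" for x y
    using s[unfolded structured_def] by (meson step_fun_unit_valued unit_valued_def)+
  have "coupled (\<lambda>x y z. A x y * B y z * C x z) \<le>
      coupled (\<lambda>x y z. ?ind x y z + (A x y * of_bool (f x y < t) +
        (B y z * of_bool (f' y z < t) + C x z * of_bool (f'' x z < t))))"
  proof (rule coupled_mono)
    fix x y z
    have u: "0 \<le> A x y" "A x y \<le> 1" "0 \<le> B y z" "B y z \<le> 1" "0 \<le> C x z" "C x z \<le> 1"
      using unit by (auto simp: unit_valued_def)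
    have ab: "0 \<le> A x y * B y z" "A x y * B y z \<le> A x y" "A x y * B y z \<le> B y z" "A x y * B y z \<le> 1"
      using u by (auto simp: mult_left_le mult_left_le_one_le mult_le_one)
    have "A x y * B y z * C x z \<le> A x y * B y z" "A x y * B y z * C x z \<le> C x z"
      using ab u by (auto simp: mult_left_le mult_left_le_one_le)
    then show "A x y * B y z * C x z \<le> ?ind x y z + (A x y * of_bool (f x y < t) +
        (B y z * of_bool (f' y z < t) + C x z * of_bool (f'' x z < t)))"
      using ab u by (cases "t \<le> f x y"; cases "t \<le> f' y z"; cases "t \<le> f'' x z") auto
  qed
  also have "\<dots> = coupled ?ind + (avg (\<lambda>x y. A x y * of_bool (f x y < t)) +
      (avg (\<lambda>x y. B x y * of_bool (f' x y < t)) + avg (\<lambda>x y. C x y * of_bool (f'' x y < t))))"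
    unfolding coupled_add coupled_xy coupled_yz coupled_xz ..
  also have "\<dots> \<le> coupled ?ind + (m + (m + m))"
    unfolding m_def by (intro add_mono order_refl structured_low_mass[OF s(1) unit(1) assms(7,8)]
      structured_low_mass[OF s(2) unit(2) assms(7,8)] structured_low_mass[OF s(3) unit(3) assms(7,8)])
  finally have "t ^ 3 * (coupled (\<lambda>x y z. A x y * B y z * C x z) - 3 * m) \<le> t ^ 3 * coupled ?ind"
    using assms(7) by (intro mult_left_mono) auto
  also have "\<dots> = coupled (\<lambda>x y z. t ^ 3 * ?ind x y z)" by (simp only: coupled_cmult)
  also have "\<dots> \<le> coupled (\<lambda>x y z. f x y * f' y z * f'' x z)"
  proof (rule coupled_mono)
    fix x y z
    show "t ^ 3 * ?ind x y z \<le> f x y * f' y z * f'' x z"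
    proof (cases "t \<le> f x y \<and> t \<le> f' y z \<and> t \<le> f'' x z")
      case True
      then have "t * t * t \<le> f x y * f' y z * f'' x z"
        using assms(7) uf by (intro mult_mono mult_nonneg_nonneg) auto
      then show ?thesis using True by (simp add: power3_eq_cube)
    next
      case False
      then show ?thesis using uf by (auto simp: of_bool_def)
    qed
  qed
  finally show ?thesis unfolding m_def .
qed

end

lemma prod3_diff_le:
  fixes a b c a' b' c' :: real
  assumes "0 \<le> a \<and> a \<le> 1" "0 \<le> b \<and> b \<le> 1" "0 \<le> c \<and> c \<le> 1"
    "0 \<le> a' \<and> a' \<le> 1" "0 \<le> b' \<and> b' \<le> 1" "0 \<le> c' \<and> c' \<le> 1"
  shows "a * b * c \<le> a' * b' * c' + \<bar>a' - a\<bar> + \<bar>b' - b\<bar> + \<bar>c' - c\<bar>"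
proof -
  have "a * b * c - a' * b' * c' = (a - a') * (b * c) + (b - b') * (a' * c) + (c - c') * (a' * b')"
    by (simp add: algebra_simps)
  moreover have "t * u \<le> \<bar>t\<bar>" if "0 \<le> u" "u \<le> 1" for t u :: real
    using mult_left_le[of u "\<bar>t\<bar>"] mult_right_mono[of t "\<bar>t\<bar>" u] that by linarith
  from this[of "b * c" "a - a'"] this[of "a' * c" "b - b'"] this[of "a' * b'" "c - c'"]
  have "(a - a') * (b * c) \<le> \<bar>a - a'\<bar>" "(b - b') * (a' * c) \<le> \<bar>b - b'\<bar>" "(c - c') * (a' * b') \<le> \<bar>c - c'\<bar>"
    using assms by (simp_all add: mult_le_one)
  ultimately show ?thesis by linarith
qed

context coupling begin

text \<open>
  The coupling is spread out uniformly over the cells of the partitions \<open>P\<close>, \<open>Q\<close>, \<open>R\<close>. This keeps its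
  two-dimensional marginals, so replacing the step functions by their approximants costs little, and
  on every cell that is not small it is dominated by a multiple of the product weight.
\<close>

lemma triangles_ge_of_step:
  fixes P Q R :: "'b \<Rightarrow> 'c" and a b c :: "'c \<Rightarrow> 'c \<Rightarrow> real"
  assumes I: "finite I" "card I = n" "1 \<le> n" "P ` V \<subseteq> I" "Q ` V \<subseteq> I" "R ` V \<subseteq> I"
    and unit: "unit_valued a" "unit_valued b" "unit_valued c"
      "unit_valued g" "unit_valued g'" "unit_valued g''"
    and "0 < \<theta>" and \<theta>: "\<theta> \<le> coupled (\<lambda>x y z. a (P x) (Q y) * b (Q y) (R z) * c (P x) (R z))"
    and close: "avg (\<lambda>x y. \<bar>g x y - a (P x) (Q y)\<bar>) \<le> \<theta> / 6"
      "avg (\<lambda>y z. \<bar>g' y z - b (Q y) (R z)\<bar>) \<le> \<theta> / 6"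
      "avg (\<lambda>x z. \<bar>g'' x z - c (P x) (R z)\<bar>) \<le> \<theta> / 6"
  shows "(\<theta> / (4 * real n ^ 3)) ^ 4 \<le> triangles g g' g''"
proof (rule ccontr)
  \<comment> \<open>At most n^3 cells lose \<open>\<tau>\<close> each, in total
    \<open>\<theta> / 4\<close>. Together with three errors of \<open>\<theta> / 6\<close> this
    stays below \<open>\<theta>\<close>, which is the contradiction sought.\<close>
  define \<tau> where "\<tau> = \<theta> / (4 * real n ^ 3)"
  assume "\<not> ?thesis"
  then have small: "triangles g g' g'' < \<tau> ^ 4" by (simp add: \<tau>_def)
  have \<tau>: "0 < \<tau>" using assms(3,13) by (simp add: \<tau>_def)
  note unit' = unit[unfolded unit_valued_def, rule_format]
  define X where "X i = {x \<in> V. P x = i}" for i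
  define Y where "Y i = {x \<in> V. Q x = i}" for i
  define Z where "Z i = {x \<in> V. R x = i}" for i
  have sub: "x \<in> X i \<Longrightarrow> x \<in> V" "x \<in> Y i \<Longrightarrow> x \<in> V" "x \<in> Z i \<Longrightarrow> x \<in> V" for x i
    by (auto simp: X_def Y_def Z_def)
  have groupX: "(\<Sum>i\<in>I. \<Sum>x\<in>X i. h x) = (\<Sum>x\<in>V. h x)" for h :: "'b \<Rightarrow> real"
    unfolding X_def by (rule sum.group[OF fin I(1) I(4)])
  have groupY: "(\<Sum>i\<in>I. \<Sum>x\<in>Y i. h x) = (\<Sum>x\<in>V. h x)" for h :: "'b \<Rightarrow> real"
    unfolding Y_def by (rule sum.group[OF fin I(1) I(5)])
  have groupZ: "(\<Sum>i\<in>I. \<Sum>x\<in>Z i. h x) = (\<Sum>x\<in>V. h x)" for h :: "'b \<Rightarrow> real"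
    unfolding Z_def by (rule sum.group[OF fin I(1) I(6)])
  have swapY: "(\<Sum>j\<in>I. \<Sum>x\<in>A. \<Sum>y\<in>Y j. h x y) = (\<Sum>x\<in>A. \<Sum>y\<in>V. h x y)"
    for A and h :: "'b \<Rightarrow> 'b \<Rightarrow> real"
    by (subst sum.swap) (simp only: groupY)
  have swapZ: "(\<Sum>j\<in>I. \<Sum>x\<in>A. \<Sum>z\<in>Z j. h x z) = (\<Sum>x\<in>A. \<Sum>z\<in>V. h x z)"
    for A and h :: "'b \<Rightarrow> 'b \<Rightarrow> real"
    by (subst sum.swap) (simp only: groupZ)
  have swapYZ: "(\<Sum>l\<in>I. \<Sum>x\<in>A. \<Sum>y\<in>B. \<Sum>z\<in>Z l. h x y z) = (\<Sum>x\<in>A. \<Sum>y\<in>B. \<Sum>z\<in>V. h x y z)"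
    for A B and h :: "'b \<Rightarrow> 'b \<Rightarrow> 'b \<Rightarrow> real"
    by (subst sum.swap) (simp only: swapZ)
  define mX where "mX i = (\<Sum>x\<in>X i. w x)" for i
  define mY where "mY i = (\<Sum>x\<in>Y i. w x)" for i
  define mZ where "mZ i = (\<Sum>x\<in>Z i. w x)" for i
  have m_nonneg: "0 \<le> mX i" "0 \<le> mY i" "0 \<le> mZ i" for i
    unfolding mX_def mY_def mZ_def by (auto intro!: sum_nonneg w_nonneg dest: sub)
  have m_le: "mX i \<le> 1" "mY i \<le> 1" "mZ i \<le> 1" for i
    unfolding mX_def mY_def mZ_def w_sum[symmetric]
    by (intro sum_mono2 fin w_nonneg; auto simp: X_def Y_def Z_def)+
  \<comment> \<open>On one cell, \<open>r\<close> is the coupling mass, \<open>v\<close> the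
    triangle weight and \<open>\<phi>\<close> the constant step product; \<open>\<alpha>\<close>,
    \<open>\<beta>\<close>, \<open>\<gamma>\<close> are the L1 errors on the three faces.\<close>
  define r where "r i j l = (\<Sum>x\<in>X i. \<Sum>y\<in>Y j. \<Sum>z\<in>Z l. \<rho> x y z)" for i j l
  define v where "v i j l = (\<Sum>x\<in>X i. \<Sum>y\<in>Y j. \<Sum>z\<in>Z l. w x * w y * w z * (g x y * g' y z * g'' x z))" for i j l
  define \<alpha> where "\<alpha> i j = (\<Sum>x\<in>X i. \<Sum>y\<in>Y j. w x * w y * \<bar>g x y - a (P x) (Q y)\<bar>)" for i j
  define \<beta> where "\<beta> j l = (\<Sum>y\<in>Y j. \<Sum>z\<in>Z l. w y * w z * \<bar>g' y z - b (Q y) (R z)\<bar>)" for j l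
  define \<gamma> where "\<gamma> i l = (\<Sum>x\<in>X i. \<Sum>z\<in>Z l. w x * w z * \<bar>g'' x z - c (P x) (R z)\<bar>)" for i l
  define \<phi> where "\<phi> i j l = a i j * b j l * c i l" for i j l
  have nonneg: "0 \<le> r i j l" "0 \<le> v i j l" "0 \<le> \<alpha> i j" "0 \<le> \<beta> j l" "0 \<le> \<gamma> i l" for i j l
    unfolding r_def v_def \<alpha>_def \<beta>_def \<gamma>_def
    using unit' by (auto intro!: sum_nonneg mult_nonneg_nonneg w_nonneg rho_nonneg dest: sub)
  have r_xy: "(\<Sum>l\<in>I. r i j l) = mX i * mY j" for i j
  proof -
    have "(\<Sum>l\<in>I. r i j l) = (\<Sum>x\<in>X i. \<Sum>y\<in>Y j. \<Sum>z\<in>V. \<rho> x y z)"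
      unfolding r_def by (rule swapYZ)
    also have "\<dots> = (\<Sum>x\<in>X i. \<Sum>y\<in>Y j. w x * w y)"
      by (intro sum.cong refl marginal_xy) (auto dest: sub)
    finally show ?thesis by (simp add: mX_def mY_def sum_product)
  qed
  have r_xz: "(\<Sum>j\<in>I. r i j l) = mX i * mZ l" for i l
  proof -
    have "(\<Sum>j\<in>I. r i j l) = (\<Sum>x\<in>X i. \<Sum>y\<in>V. \<Sum>z\<in>Z l. \<rho> x y z)"
      unfolding r_def by (rule swapY)
    also have "\<dots> = (\<Sum>x\<in>X i. \<Sum>z\<in>Z l. \<Sum>y\<in>V. \<rho> x y z)"
      by (intro sum.cong refl sum.swap)
    also have "\<dots> = (\<Sum>x\<in>X i. \<Sum>z\<in>Z l. w x * w z)"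
      by (intro sum.cong refl marginal_xz) (auto dest: sub)
    finally show ?thesis by (simp add: mX_def mZ_def sum_product)
  qed
  have r_yz: "(\<Sum>i\<in>I. r i j l) = mY j * mZ l" for j l
  proof -
    have "(\<Sum>i\<in>I. r i j l) = (\<Sum>x\<in>V. \<Sum>y\<in>Y j. \<Sum>z\<in>Z l. \<rho> x y z)"
      unfolding r_def by (rule groupX)
    also have "\<dots> = (\<Sum>y\<in>Y j. \<Sum>z\<in>Z l. \<Sum>x\<in>V. \<rho> x y z)"
      by (subst sum.swap) (intro sum.cong refl sum.swap)
    also have "\<dots> = (\<Sum>y\<in>Y j. \<Sum>z\<in>Z l. w y * w z)"
      by (intro sum.cong refl marginal_yz) (auto dest: sub)
    finally show ?thesis by (simp add: mY_def mZ_def sum_product)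
  qed
  have r_le: "r i j l \<le> mX i" "r i j l \<le> mY j" "r i j l \<le> mZ l" if "i \<in> I" "j \<in> I" "l \<in> I" for i j l
  proof -
    have "r i j l \<le> mX i * mY j" "r i j l \<le> mY j * mZ l"
      unfolding r_xy[symmetric] r_yz[symmetric] using that nonneg(1) I(1)
      by (auto intro!: member_le_sum[of l I "\<lambda>l. r i j l"] member_le_sum[of i I "\<lambda>i. r i j l"])
    moreover have "mX i * mY j \<le> mX i" "mX i * mY j \<le> mY j" "mY j * mZ l \<le> mZ l"
      using m_nonneg m_le by (simp_all add: mult_left_le mult_left_le_one_le)
    ultimately show "r i j l \<le> mX i" "r i j l \<le> mY j" "r i j l \<le> mZ l" by linarith+
  qed
  have cell_const: "(\<Sum>x\<in>X i. \<Sum>y\<in>Y j. \<Sum>z\<in>Z l. w x * w y * w z * k) = mX i * mY j * mZ l * k" for i j l k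
    by (simp add: mX_def mY_def mZ_def sum_distrib_left[symmetric] sum_distrib_right[symmetric])
  have v_le: "v i j l \<le> mX i * mY j * mZ l" for i j l
  proof -
    have "v i j l \<le> (\<Sum>x\<in>X i. \<Sum>y\<in>Y j. \<Sum>z\<in>Z l. w x * w y * w z * 1)"
      unfolding v_def
    proof (intro sum_mono mult_left_mono mult_nonneg_nonneg w_nonneg)
      fix x y z
      show "g x y * g' y z * g'' x z \<le> 1"
        using unit' by (intro mult_le_one mult_nonneg_nonneg) auto
    qed (auto dest: sub)
    then show ?thesis unfolding cell_const by simp
  qed
  have v_ge: "mX i * mY j * mZ l * \<phi> i j l \<le> v i j l + \<alpha> i j * mZ l + \<beta> j l * mX i + \<gamma> i l * mY j" for i j l
  proof -
    have "mX i * mY j * mZ l * \<phi> i j l = (\<Sum>x\<in>X i. \<Sum>y\<in>Y j. \<Sum>z\<in>Z l. w x * w y * w z * \<phi> i j l)"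
      by (rule cell_const[symmetric])
    also have "\<dots> \<le> (\<Sum>x\<in>X i. \<Sum>y\<in>Y j. \<Sum>z\<in>Z l. w x * w y * w z * (g x y * g' y z * g'' x z
        + \<bar>g x y - a (P x) (Q y)\<bar> + \<bar>g' y z - b (Q y) (R z)\<bar> + \<bar>g'' x z - c (P x) (R z)\<bar>))"
    proof (intro sum_mono mult_left_mono mult_nonneg_nonneg w_nonneg)
      fix x y z assume "x \<in> X i" "y \<in> Y j" "z \<in> Z l"
      then have "\<phi> i j l = a (P x) (Q y) * b (Q y) (R z) * c (P x) (R z)"
        by (simp add: \<phi>_def X_def Y_def Z_def)
      also have "\<dots> \<le> g x y * g' y z * g'' x z
        + \<bar>g x y - a (P x) (Q y)\<bar> + \<bar>g' y z - b (Q y) (R z)\<bar> + \<bar>g'' x z - c (P x) (R z)\<bar>"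
        using unit' by (intro prod3_diff_le) auto
      finally show "\<phi> i j l \<le> \<dots>" .
    qed (auto dest: sub)
    also have "\<dots> = v i j l
        + (\<Sum>x\<in>X i. \<Sum>y\<in>Y j. \<Sum>z\<in>Z l. w x * w y * w z * \<bar>g x y - a (P x) (Q y)\<bar>)
        + (\<Sum>x\<in>X i. \<Sum>y\<in>Y j. \<Sum>z\<in>Z l. w x * w y * w z * \<bar>g' y z - b (Q y) (R z)\<bar>)
        + (\<Sum>x\<in>X i. \<Sum>y\<in>Y j. \<Sum>z\<in>Z l. w x * w y * w z * \<bar>g'' x z - c (P x) (R z)\<bar>)"
      unfolding v_def by (simp only: distrib_left sum.distrib)
    also have "(\<Sum>x\<in>X i. \<Sum>y\<in>Y j. \<Sum>z\<in>Z l. w x * w y * w z * \<bar>g x y - a (P x) (Q y)\<bar>) = \<alpha> i j * mZ l"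
      unfolding \<alpha>_def sum_distrib_right
      by (intro sum.cong refl) (simp add: mZ_def sum_distrib_left sum_distrib_right mult_ac)
    also have "(\<Sum>x\<in>X i. \<Sum>y\<in>Y j. \<Sum>z\<in>Z l. w x * w y * w z * \<bar>g' y z - b (Q y) (R z)\<bar>) = \<beta> j l * mX i"
      unfolding \<beta>_def mX_def mult.commute[of _ "sum w (X i)"] sum_distrib_right[of w]
      by (intro sum.cong refl) (simp add: sum_distrib_left mult_ac)
    also have "(\<Sum>x\<in>X i. \<Sum>y\<in>Y j. \<Sum>z\<in>Z l. w x * w y * w z * \<bar>g'' x z - c (P x) (R z)\<bar>)
        = (\<Sum>x\<in>X i. \<Sum>z\<in>Z l. \<Sum>y\<in>Y j. w x * w y * w z * \<bar>g'' x z - c (P x) (R z)\<bar>)"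
      by (intro sum.cong refl sum.swap)
    also have "\<dots> = \<gamma> i l * mY j"
      unfolding \<gamma>_def sum_distrib_right
      by (intro sum.cong refl) (simp add: mY_def sum_distrib_left sum_distrib_right mult_ac)
    finally show ?thesis .
  qed
  have v_small: "v i j l < \<tau> ^ 4" if "i \<in> I" "j \<in> I" "l \<in> I" for i j l
  proof -
    have "v i j l \<le> (\<Sum>l\<in>I. v i j l)"
      using that nonneg(2) I(1) by (intro member_le_sum) auto
    also have "\<dots> \<le> (\<Sum>j\<in>I. \<Sum>l\<in>I. v i j l)"
      using that nonneg(2) I(1) by (intro member_le_sum[of j I "\<lambda>j. \<Sum>l\<in>I. v i j l"]) (auto intro: sum_nonneg)
    also have "\<dots> \<le> (\<Sum>i\<in>I. \<Sum>j\<in>I. \<Sum>l\<in>I. v i j l)"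
      using that nonneg(2) I(1) by (intro member_le_sum[of i I "\<lambda>i. \<Sum>j\<in>I. \<Sum>l\<in>I. v i j l"]) (auto intro!: sum_nonneg)
    also have "\<dots> = triangles g g' g''"
      unfolding v_def triangles_def by (simp only: swapYZ swapY groupX)
    finally show ?thesis using small by linarith
  qed
  \<comment> \<open>With the mass of the cell spread proportionally to the product weight,
    \<open>\<phi>\<close> is at most the mean \<open>v i j l / \<mu>\<close> plus the mean errors on
    the faces.\<close>
  have cell: "r i j l * \<phi> i j l \<le> \<tau> + r i j l * (\<alpha> i j / (mX i * mY j)) + r i j l * (\<beta> j l / (mY j * mZ l))
      + r i j l * (\<gamma> i l / (mX i * mZ l))" if ijl: "i \<in> I" "j \<in> I" "l \<in> I" for i j l
  proof (cases "r i j l = 0")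
    case True
    then show ?thesis using \<tau> by simp
  next
    case False
    then have pos: "0 < r i j l" using nonneg(1)[of i j l] by linarith
    with r_le[OF ijl] have m: "0 < mX i" "0 < mY j" "0 < mZ l" by linarith+
    define \<mu> where "\<mu> = mX i * mY j * mZ l"
    have \<mu>: "0 < \<mu>" using m by (simp add: \<mu>_def)
    have "\<phi> i j l = mX i * mY j * mZ l * \<phi> i j l / \<mu>" using m by (simp add: \<mu>_def)
    also have "\<dots> \<le> (v i j l + \<alpha> i j * mZ l + \<beta> j l * mX i + \<gamma> i l * mY j) / \<mu>"
      using v_ge \<mu> by (intro divide_right_mono) auto
    also have "\<dots> = v i j l / \<mu> + \<alpha> i j / (mX i * mY j) + \<beta> j l / (mY j * mZ l) + \<gamma> i l / (mX i * mZ l)"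
      using m by (simp add: \<mu>_def field_simps)
    finally have "r i j l * \<phi> i j l \<le> r i j l * (v i j l / \<mu> + \<alpha> i j / (mX i * mY j) + \<beta> j l / (mY j * mZ l) + \<gamma> i l / (mX i * mZ l))"
      using pos by (intro mult_left_mono) auto
    \<comment> \<open>A light cell loses at most its mass, since \<open>v i j l \<le> \<mu>\<close>.
      In a heavy one all three sides weigh at least \<open>\<tau>\<close>, so \<open>\<mu>\<close>
      is at least \<open>\<tau>\<close> cubed while the assumed shortage makes \<open>v\<close> less
      than \<open>\<tau> ^ 4\<close>.\<close>
    moreover have "r i j l * (v i j l / \<mu>) \<le> \<tau>"
    proof (cases "r i j l \<le> \<tau>")
      case True
      have "v i j l / \<mu> \<le> 1" using v_le[of i j l] \<mu> by (simp add: \<mu>_def)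
      then have "r i j l * (v i j l / \<mu>) \<le> \<tau> * 1"
        using True \<tau> \<mu> nonneg(2) by (intro mult_mono) auto
      then show ?thesis by simp
    next
      case False
      then have "\<tau> \<le> mX i" "\<tau> \<le> mY j" "\<tau> \<le> mZ l" using r_le[OF ijl] by linarith+
      then have "\<tau> * \<tau> * \<tau> \<le> \<mu>"
        unfolding \<mu>_def using \<tau> by (intro mult_mono mult_nonneg_nonneg) auto
      then have "\<tau> * (\<tau> * \<tau> * \<tau>) \<le> \<tau> * \<mu>" using \<tau> by (intro mult_left_mono) auto
      then have "v i j l \<le> \<tau> * \<mu>"
        using v_small[OF ijl] by (simp add: power4_eq_xxxx mult_ac)
      then have "v i j l / \<mu> \<le> \<tau>" using \<mu> by (simp add: field_simps)
      moreover have "r i j l \<le> 1" using r_le(1)[OF ijl] m_le(1)[of i] by linarith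
      ultimately have "r i j l * (v i j l / \<mu>) \<le> 1 * \<tau>"
        using \<mu> nonneg(2) by (intro mult_mono) auto
      then show ?thesis by simp
    qed
    ultimately show ?thesis by (simp add: distrib_left)
  qed
  \<comment> \<open>Summing \<open>r\<close> over the index absent from a face cancels the
    denominator. For \<open>m = 0\<close> the quotient is 0 by convention and the bound still
    holds.\<close>
  have cancel: "(\<Sum>l\<in>I. f l * (t / m)) \<le> t" if "(\<Sum>l\<in>I. f l) = m" "0 \<le> t" for f :: "'c \<Rightarrow> real" and t m
    unfolding sum_distrib_right[symmetric] that(1) using that(2) by simp
  have "\<theta> \<le> (\<Sum>i\<in>I. \<Sum>j\<in>I. \<Sum>l\<in>I. r i j l * \<phi> i j l)"
  proof -
    have "r i j l * \<phi> i j l = (\<Sum>x\<in>X i. \<Sum>y\<in>Y j. \<Sum>z\<in>Z l. \<rho> x y z * (a (P x) (Q y) * b (Q y) (R z) * c (P x) (R z)))" for i j l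
      unfolding r_def \<phi>_def sum_distrib_right by (intro sum.cong refl) (simp add: X_def Y_def Z_def)
    then show ?thesis using \<theta> unfolding coupled_def by (simp only: swapYZ swapY groupX)
  qed
  also have "\<dots> \<le> (\<Sum>i\<in>I. \<Sum>j\<in>I. \<Sum>l\<in>I. \<tau> + r i j l * (\<alpha> i j / (mX i * mY j)) + r i j l * (\<beta> j l / (mY j * mZ l))
      + r i j l * (\<gamma> i l / (mX i * mZ l)))"
    by (intro sum_mono cell)
  also have "\<dots> = (\<Sum>i\<in>I. \<Sum>j\<in>I. \<Sum>l\<in>I. \<tau>) + (\<Sum>i\<in>I. \<Sum>j\<in>I. \<Sum>l\<in>I. r i j l * (\<alpha> i j / (mX i * mY j)))
      + (\<Sum>i\<in>I. \<Sum>j\<in>I. \<Sum>l\<in>I. r i j l * (\<beta> j l / (mY j * mZ l)))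
      + (\<Sum>i\<in>I. \<Sum>j\<in>I. \<Sum>l\<in>I. r i j l * (\<gamma> i l / (mX i * mZ l)))"
    by (simp only: sum.distrib)
  also have "(\<Sum>i\<in>I. \<Sum>j\<in>I. \<Sum>l\<in>I. \<tau>) = \<theta> / 4"
    using I(2,3) by (simp add: \<tau>_def power3_eq_cube)
  also have "(\<Sum>i\<in>I. \<Sum>j\<in>I. \<Sum>l\<in>I. r i j l * (\<alpha> i j / (mX i * mY j))) \<le> \<theta> / 6"
  proof -
    have "(\<Sum>i\<in>I. \<Sum>j\<in>I. \<Sum>l\<in>I. r i j l * (\<alpha> i j / (mX i * mY j))) \<le> (\<Sum>i\<in>I. \<Sum>j\<in>I. \<alpha> i j)"
      by (intro sum_mono cancel r_xy nonneg)
    also have "\<dots> = avg (\<lambda>x y. \<bar>g x y - a (P x) (Q y)\<bar>)"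
      unfolding \<alpha>_def avg_def by (simp only: swapY groupX)
    finally show ?thesis using close(1) by linarith
  qed
  also have "(\<Sum>i\<in>I. \<Sum>j\<in>I. \<Sum>l\<in>I. r i j l * (\<beta> j l / (mY j * mZ l))) \<le> \<theta> / 6"
  proof -
    have "(\<Sum>i\<in>I. \<Sum>j\<in>I. \<Sum>l\<in>I. r i j l * (\<beta> j l / (mY j * mZ l)))
      = (\<Sum>j\<in>I. \<Sum>i\<in>I. \<Sum>l\<in>I. r i j l * (\<beta> j l / (mY j * mZ l)))"
      by (rule sum.swap)
    also have "\<dots> = (\<Sum>j\<in>I. \<Sum>l\<in>I. \<Sum>i\<in>I. r i j l * (\<beta> j l / (mY j * mZ l)))"
      by (intro sum.cong refl sum.swap)
    also have "\<dots> \<le> (\<Sum>j\<in>I. \<Sum>l\<in>I. \<beta> j l)"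
      by (intro sum_mono cancel r_yz nonneg)
    also have "\<dots> = avg (\<lambda>y z. \<bar>g' y z - b (Q y) (R z)\<bar>)"
      unfolding \<beta>_def avg_def by (simp only: swapZ groupY)
    finally show ?thesis using close(2) by linarith
  qed
  also have "(\<Sum>i\<in>I. \<Sum>j\<in>I. \<Sum>l\<in>I. r i j l * (\<gamma> i l / (mX i * mZ l))) \<le> \<theta> / 6"
  proof -
    have "(\<Sum>i\<in>I. \<Sum>j\<in>I. \<Sum>l\<in>I. r i j l * (\<gamma> i l / (mX i * mZ l)))
      = (\<Sum>i\<in>I. \<Sum>l\<in>I. \<Sum>j\<in>I. r i j l * (\<gamma> i l / (mX i * mZ l)))"
      by (intro sum.cong refl sum.swap)
    also have "\<dots> \<le> (\<Sum>i\<in>I. \<Sum>l\<in>I. \<gamma> i l)"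
      by (intro sum_mono cancel r_xz nonneg)
    also have "\<dots> = avg (\<lambda>x z. \<bar>g'' x z - c (P x) (R z)\<bar>)"
      unfolding \<gamma>_def avg_def by (simp only: swapZ groupX)
    finally show ?thesis using close(3) by linarith
  qed
  finally show False using assms(13) by simp
qed

end

section \<open>Many triangles from a charged coupling\<close>

text \<open>The order of quantifiers is the point: \<open>\<delta>\<close> is fixed before the
  vertex set, so the lemma can be applied to arbitrarily many atoms.\<close>

lemma coupled_triangle_removal:
  assumes "0 < \<epsilon>"
  shows "\<exists>\<delta>>0. \<forall>(V :: 'b set) w \<rho> A B C.
    coupling V w \<rho> \<longrightarrow> unit_valued A \<longrightarrow> unit_valued B \<longrightarrow> unit_valued C \<longrightarrow>
      \<epsilon> \<le> coupling.coupled V \<rho> (\<lambda>x y z. A x y * B y z * C x z) \<longrightarrow>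
      \<delta> \<le> weighted_set.triangles V w A B C"
proof -
  define \<epsilon>' where "\<epsilon>' = min 1 \<epsilon>"
  have \<epsilon>': "0 < \<epsilon>'" "\<epsilon>' \<le> 1" "\<epsilon>' \<le> \<epsilon>" using assms by (auto simp: \<epsilon>'_def)
  \<comment> \<open>The threshold is t = \<open>\<epsilon>' / 10\<close>. The losses are at most 3
    times \<open>\<epsilon>' / 10 + \<epsilon>' / 60 + \<epsilon>' / 60\<close>, that is
    \<open>2 * \<epsilon>' / 5\<close>, so at least \<open>\<epsilon>' / 2\<close> is left to
    multiply t^3.\<close>
  define \<theta> where "\<theta> = (\<epsilon>' / 10) ^ 3 * (\<epsilon>' / 2)"
  have \<theta>: "0 < \<theta>" using \<epsilon>' by (simp add: \<theta>_def)
  have "(\<epsilon>' / 10) ^ 3 * (\<epsilon>' / 2) \<le> (1 / 10) ^ 3 * (\<epsilon>' / 2)"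
    using \<epsilon>' by (intro mult_right_mono power_mono) auto
  then have \<theta>_le: "\<theta> / 6 \<le> \<epsilon>' / 60" using \<epsilon>' unfolding \<theta>_def by (simp add: power3_eq_cube)
  define \<tau> where "\<tau> k = \<theta> / (4 * real (k * k) ^ 3)" for k
  have \<tau>: "0 < \<tau> k" if "1 \<le> k" for k using \<theta> that by (simp add: \<tau>_def)
  \<comment> \<open>The first term keeps the cut losses on k^2 rectangles below
    \<open>\<epsilon>' / 60\<close>; the second lets the counting lemma lose at most half of
    \<open>\<tau> k ^ 4\<close>.\<close>
  define \<eta> where "\<eta> k = min (\<epsilon>' / (60 * (real k)\<^sup>2)) (\<tau> k ^ 4 / 6)" for k
  have \<eta>: "0 < \<eta> k" if "1 \<le> k" for k using \<epsilon>' \<tau>[OF that] that by (simp add: \<eta>_def)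
  obtain K where K: "\<And>(V :: 'b set) w A B C.
    weighted_set V w \<Longrightarrow> unit_valued A \<Longrightarrow> unit_valued B \<Longrightarrow> unit_valued C \<Longrightarrow>
    \<exists>k f f' f'' g g' g''. 1 \<le> k \<and> k \<le> K \<and> weighted_set.structured V w (\<theta> / 6) (\<eta> k) k A f g \<and>
      weighted_set.structured V w (\<theta> / 6) (\<eta> k) k B f' g' \<and> weighted_set.structured V w (\<theta> / 6) (\<eta> k) k C f'' g''"
    using regularity[of "\<theta> / 6" \<eta>] \<theta> \<eta> by (metis divide_pos_pos zero_less_numeral)
  show ?thesis
  \<comment> \<open>\<open>\<tau>\<close> decreases on positive \<open>k\<close>, and
    \<open>max 1 K\<close> avoids \<open>\<tau> 0\<close>, which is 0 by division by zero.\<close>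
  proof (intro exI[of _ "\<tau> (max 1 K) ^ 4 / 2"] conjI allI impI)
    show "0 < \<tau> (max 1 K) ^ 4 / 2" using \<tau>[of "max 1 K"] by simp
    fix V :: "'b set" and w \<rho> and A B C :: "'b \<Rightarrow> 'b \<Rightarrow> real"
    assume coup: "coupling V w \<rho>" and unit: "unit_valued A" "unit_valued B" "unit_valued C"
      and large: "\<epsilon> \<le> coupling.coupled V \<rho> (\<lambda>x y z. A x y * B y z * C x z)"
    interpret coupling V w \<rho> by (rule coup)
    obtain k f f' f'' g g' g'' where k: "1 \<le> k" "k \<le> K"
      and s: "structured (\<theta> / 6) (\<eta> k) k A f g" "structured (\<theta> / 6) (\<eta> k) k B f' g'"
        "structured (\<theta> / 6) (\<eta> k) k C f'' g''"
      using K[OF weighted_set_axioms unit] by blast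
    have "(real k)\<^sup>2 * \<eta> k \<le> (real k)\<^sup>2 * (\<epsilon>' / (60 * (real k)\<^sup>2))"
      by (intro mult_left_mono) (auto simp: \<eta>_def)
    also have "\<dots> = \<epsilon>' / 60" using k(1) by simp
    finally have "\<epsilon>' / 2 \<le> coupled (\<lambda>x y z. A x y * B y z * C x z) - 3 * (\<epsilon>' / 10 + \<theta> / 6 + (real k)\<^sup>2 * \<eta> k)"
      using large \<theta>_le \<epsilon>' by argo
    then have "\<theta> \<le> (\<epsilon>' / 10) ^ 3 * (coupled (\<lambda>x y z. A x y * B y z * C x z)
        - 3 * (\<epsilon>' / 10 + \<theta> / 6 + (real k)\<^sup>2 * \<eta> k))"
      using \<epsilon>' unfolding \<theta>_def by (intro mult_left_mono) auto
    also have "\<dots> \<le> coupled (\<lambda>x y z. f x y * f' y z * f'' x z)"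
      using \<epsilon>' \<eta>[OF k(1)] by (intro coupled_step_ge[OF unit s]) auto
    finally have big: "\<theta> \<le> coupled (\<lambda>x y z. f x y * f' y z * f'' x z)" .
    obtain p q a where f: "\<forall>x. p x < k" "\<forall>y. q y < k" "unit_valued a" "f = (\<lambda>x y. a (p x) (q y))"
      using s(1) unfolding step_fun_def structured_def by metis
    obtain p' q' b where f': "\<forall>x. p' x < k" "\<forall>y. q' y < k" "unit_valued b" "f' = (\<lambda>x y. b (p' x) (q' y))"
      using s(2) unfolding step_fun_def structured_def by metis
    obtain p'' q'' c where f'': "\<forall>x. p'' x < k" "\<forall>y. q'' y < k" "unit_valued c" "f'' = (\<lambda>x y. c (p'' x) (q'' y))"
      using s(3) unfolding step_fun_def structured_def by metis
    \<comment> \<open>Each vertex class occurs in two of the step functions, with a different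
      partition in each. Pairs of labels give the common refinement, whence \<open>k * k\<close>
      cells.\<close>
    have "(\<theta> / (4 * real (k * k) ^ 3)) ^ 4 \<le> triangles g g' g''"
    proof (rule triangles_ge_of_step[where I = "{..<k} \<times> {..<k}" and P = "\<lambda>x. (p x, p'' x)"
          and Q = "\<lambda>y. (q y, p' y)" and R = "\<lambda>z. (q' z, q'' z)" and a = "\<lambda>i j. a (fst i) (fst j)"
          and b = "\<lambda>j l. b (snd j) (fst l)" and c = "\<lambda>i l. c (snd i) (snd l)" and \<theta> = \<theta>])
      show "\<theta> \<le> coupled (\<lambda>x y z. a (fst (p x, p'' x)) (fst (q y, p' y)) *
          b (snd (q y, p' y)) (fst (q' z, q'' z)) * c (snd (p x, p'' x)) (snd (q' z, q'' z)))"
        using big f(4) f'(4) f''(4) by simp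
    qed (use k \<theta> f f' f'' s in \<open>auto simp: structured_def unit_valued_def\<close>)
    then have "\<tau> k ^ 4 - 3 * \<eta> k \<le> triangles g g' g'' - 3 * \<eta> k" by (simp add: \<tau>_def)
    also have "\<dots> \<le> triangles A B C"
      using s by (intro triangles_counting unit) (auto simp: structured_def)
    finally have "\<tau> k ^ 4 / 2 \<le> triangles A B C" unfolding \<eta>_def by linarith
    moreover have "\<tau> (max 1 K) \<le> \<tau> k"
      unfolding \<tau>_def using k \<theta> by (intro divide_left_mono mult_left_mono power_mono of_nat_mono mult_le_mono) auto
    then have "\<tau> (max 1 K) ^ 4 \<le> \<tau> k ^ 4"
      using \<tau>[of "max 1 K"] by (intro power_mono) auto
    ultimately show "\<tau> (max 1 K) ^ 4 / 2 \<le> triangles A B C" by linarith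
  qed
qed

section \<open>Haar measure on compact abelian groups\<close>

text \<open>No normalisation is imposed, so that slices of a Haar measure on a product, which may
  even be null, are covered. Inner approximation of all Borel sets by compact sets survives
  continuous images.\<close>

definition invariant_regular :: "'a::{topological_ab_group_add, t2_space} measure \<Rightarrow> bool" where
  "invariant_regular M \<longleftrightarrow> finite_measure M \<and> sets M = sets borel \<and>
     (\<forall>B\<in>sets borel. \<forall>e>0. \<exists>K. compact K \<and> K \<subseteq> B \<and> measure M (B - K) < e) \<and>
     (\<forall>g. \<forall>B\<in>sets borel. measure M ((+) g -` B) = measure M B)"

lemma invariant_regularD:
  assumes "invariant_regular M"
  shows "finite_measure M" "sets M = sets borel" "space M = UNIV"
    "\<And>B e. B \<in> sets borel \<Longrightarrow> e > 0 \<Longrightarrow> \<exists>K. compact K \<and> K \<subseteq> B \<and> measure M (B - K) < e"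
    "\<And>B g. B \<in> sets borel \<Longrightarrow> measure M ((+) g -` B) = measure M B"
  using assms sets_eq_imp_space_eq[of M borel] unfolding invariant_regular_def by auto

lemma vimage_borel:
  fixes f :: "'a::topological_space \<Rightarrow> 'b::topological_space"
  assumes "continuous_on UNIV f" "B \<in> sets borel"
  shows "f -` B \<in> sets borel"
  using measurable_sets[OF borel_measurable_continuous_onI[OF assms(1)] assms(2)] by simp

lemma haar_outer_regular:
  assumes "haar_prob_measure M" "B \<in> sets borel" "0 < e"
  shows "\<exists>U. open U \<and> B \<subseteq> U \<and> measure M (U - B) < e"
proof -
  interpret prob_space M using assms(1) by (simp add: haar_prob_measure_def)
  have sets: "sets M = sets borel"
    and outer: "emeasure M B = (INF U\<in>{U. open U \<and> B \<subseteq> U}. emeasure M U)"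
    using assms(1,2) by (auto simp: haar_prob_measure_def regular_borel_measure_def)
  have "emeasure M B < emeasure M B + ennreal e"
    using assms(3) by (simp add: emeasure_eq_measure ennreal_plus[symmetric] ennreal_less_iff del: ennreal_plus)
  then obtain U where U: "open U" "B \<subseteq> U" "emeasure M U < emeasure M B + ennreal e"
    by (subst (asm) (1) outer) (auto simp: INF_less_iff)
  have UB: "U \<in> events" "B \<in> events" using U assms(2) by (auto simp: sets)
  have "measure M U < measure M B + e"
    using U(3) assms(3) by (simp add: emeasure_eq_measure ennreal_plus[symmetric] ennreal_less_iff del: ennreal_plus)
  then have "measure M (U - B) < e"
    using finite_measure_Diff[OF UB U(2)] by simp
  then show ?thesis using U by blast
qed

text \<open>In a compact group the complement of an open set is compact, so an outer approximation
  of \<open>- B\<close> is an inner approximation of \<open>B\<close>.\<close>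

lemma haar_invariant_regular:
  fixes M :: "'a::{topological_ab_group_add, t2_space} measure"
  assumes "haar_prob_measure M" "compact (UNIV :: 'a set)"
  shows "invariant_regular M"
proof -
  interpret prob_space M using assms(1) by (simp add: haar_prob_measure_def)
  show ?thesis unfolding invariant_regular_def
  proof (intro conjI ballI allI impI)
    show "finite_measure M" by (rule finite_measure_axioms)
    show "sets M = sets borel"
      using assms(1) by (simp add: haar_prob_measure_def regular_borel_measure_def)
  next
    fix B :: "'a set" and e :: real assume B: "B \<in> sets borel" and e: "0 < e"
    obtain U where U: "open U" "- B \<subseteq> U" "measure M (U - (- B)) < e"
      using haar_outer_regular[OF assms(1) _ e, of "- B"] B by auto
    have "compact (UNIV \<inter> (- U))"
      using U(1) assms(2) by (intro compact_Int_closed) auto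
    moreover have "B - (- U) = U - (- B)" by auto
    ultimately show "\<exists>K. compact K \<and> K \<subseteq> B \<and> measure M (B - K) < e"
      using U by (intro exI[of _ "- U"]) auto
  next
    fix g :: 'a and B :: "'a set" assume B: "B \<in> sets borel"
    have "(+) g -` B = (\<lambda>x. - g + x) ` B"
      by (auto simp: image_iff intro!: bexI[of _ "g + _"])
    then show "measure M ((+) g -` B) = measure M B"
      using assms(1) B unfolding haar_prob_measure_def measure_def by metis
  qed
qed

text \<open>Surjectivity lifts a translation by \<open>g\<close> to one by some \<open>h\<close>
  with \<open>f h = g\<close>; compact approximations are pushed forward by
  \<open>f\<close>.\<close>

lemma invariant_regular_distr:
  fixes f :: "'a::{topological_ab_group_add, t2_space} \<Rightarrow> 'b::{topological_ab_group_add, t2_space}"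
  assumes M: "invariant_regular M" and f: "continuous_on UNIV f" "\<And>x y. f (x + y) = f x + f y" "surj f"
  shows "invariant_regular (distr M borel f)"
proof -
  interpret finite_measure M using M by (rule invariant_regularD)
  note [simp] = invariant_regularD(2,3)[OF M]
  have f_meas [measurable]: "f \<in> measurable M borel"
    using borel_measurable_continuous_onI[OF f(1)] by (simp cong: measurable_cong_sets)
  have m: "measure (distr M borel f) B = measure M (f -` B)" if "B \<in> sets borel" for B
    using that by (simp add: measure_distr)
  show ?thesis unfolding invariant_regular_def
  proof (intro conjI ballI allI impI)
    show "finite_measure (distr M borel f)" by (rule finite_measure_distr) simp
    show "sets (distr M borel f) = sets borel" by simp
  next
    fix B :: "'b set" and e :: real assume B: "B \<in> sets borel" and e: "0 < e"
    obtain K where K: "compact K" "K \<subseteq> f -` B" "measure M (f -` B - K) < e"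
      using invariant_regularD(4)[OF M vimage_borel[OF f(1) B] e] by blast
    have fK: "compact (f ` K)"
      by (rule compact_continuous_image[OF continuous_on_subset[OF f(1)] K(1)]) simp
    then have "B - f ` K \<in> sets borel" using B by (auto intro: borel_compact)
    then have "measure (distr M borel f) (B - f ` K) = measure M (f -` (B - f ` K))" by (rule m)
    also have "\<dots> \<le> measure M (f -` B - K)"
      using K(1) vimage_borel[OF f(1) B] by (intro finite_measure_mono) (auto intro: borel_compact)
    finally show "\<exists>K. compact K \<and> K \<subseteq> B \<and> measure (distr M borel f) (B - K) < e"
      using K fK by (intro exI[of _ "f ` K"]) auto
  next
    fix g and B :: "'b set" assume B: "B \<in> sets borel"
    obtain h where h: "f h = g" using f(3) by (metis surjD)
    have gB: "(+) g -` B \<in> sets borel" by (intro vimage_borel B continuous_intros)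
    have "f -` ((+) g -` B) = (+) h -` (f -` B)" by (auto simp: f(2) h)
    then show "measure (distr M borel f) ((+) g -` B) = measure (distr M borel f) B"
      using invariant_regularD(5)[OF M vimage_borel[OF f(1) B], of h] by (simp add: m B gB)
  qed
qed

section \<open>Rectangles, continuous functions and uniqueness\<close>

lemma open_union_of_rectangles:
  fixes K U :: "('a::topological_space \<times> 'b::topological_space) set"
  assumes "compact K" "open U" "K \<subseteq> U"
  obtains S where "finite S" "\<forall>(A, B)\<in>S. open A \<and> open B"
    "K \<subseteq> (\<Union>(A, B)\<in>S. A \<times> B)" "(\<Union>(A, B)\<in>S. A \<times> B) \<subseteq> U"
proof -
  let ?C = "{(A, B). open A \<and> open B \<and> A \<times> B \<subseteq> U}"
  have "K \<subseteq> (\<Union>p\<in>?C. fst p \<times> snd p)"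
  proof
    fix p assume "p \<in> K"
    then have "p \<in> U" using assms(3) by auto
    then obtain A B where "open A" "open B" "p \<in> A \<times> B" "A \<times> B \<subseteq> U"
      using open_prod_elim[OF assms(2)] by metis
    then show "p \<in> (\<Union>p\<in>?C. fst p \<times> snd p)" by (intro UN_I[of "(A, B)"]) auto
  qed
  then obtain S where "S \<subseteq> ?C" "finite S" "K \<subseteq> (\<Union>p\<in>S. fst p \<times> snd p)"
    by (rule compactE_image[OF assms(1), rotated]) (auto intro: open_Times)
  then show thesis
    by (intro that[of S]) (auto simp: case_prod_unfold)
qed

text \<open>
  Without second countability this needs compactness: open subsets of the product need not belong
  to the product \<open>\<sigma>\<close>-algebra.
\<close>

lemma continuous_pair_measurable:
  fixes f :: "'a::t2_space \<times> 'b::t2_space \<Rightarrow> real"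
  assumes "compact (UNIV :: 'a set)" "compact (UNIV :: 'b set)" "continuous_on UNIV f"
  shows "f \<in> borel_measurable (borel \<Otimes>\<^sub>M borel)"
proof (rule borel_measurableI_greater)
  fix c
  have comp: "compact (UNIV :: ('a \<times> 'b) set)"
    using compact_Times[OF assms(1,2)] by simp
  let ?U = "{p. c < f p}" and ?K = "\<lambda>n. {p. c + 1 / real (Suc n) \<le> f p}"
  have U: "open ?U" using assms(3) by (intro open_Collect_less continuous_intros)
  \<comment> \<open>The open set \<open>?U\<close> is the union of the compact sets
    \<open>?K n\<close>, and a finite union of open rectangles fits between each of these and
    \<open>?U\<close>.\<close>
  have "\<exists>R. R \<in> sets (borel \<Otimes>\<^sub>M borel) \<and> ?K n \<subseteq> R \<and> R \<subseteq> ?U" for n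
  proof -
    have "closed (?K n)" using assms(3) by (intro closed_Collect_le continuous_intros)
    then have cK: "compact (?K n)" using compact_Int_closed[OF comp, of "?K n"] by simp
    have KU: "?K n \<subseteq> ?U"
    proof
      fix p assume "p \<in> ?K n"
      then have "c + 1 / real (Suc n) \<le> f p" by blast
      moreover have "0 < 1 / real (Suc n)" by simp
      ultimately have "c < f p" by linarith
      then show "p \<in> ?U" by blast
    qed
    obtain S where S: "finite S" "\<forall>(A, B)\<in>S. open A \<and> open B"
      "?K n \<subseteq> (\<Union>(A, B)\<in>S. A \<times> B)" "(\<Union>(A, B)\<in>S. A \<times> B) \<subseteq> ?U"
      by (rule open_union_of_rectangles[OF cK U KU])
    have "(\<Union>(A, B)\<in>S. A \<times> B) \<in> sets (borel \<Otimes>\<^sub>M borel)"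
      using S(1,2) by (intro sets.finite_UN) (auto intro!: pair_measureI)
    then show ?thesis using S by blast
  qed
  then obtain R where R: "\<And>n. R n \<in> sets (borel \<Otimes>\<^sub>M borel)" "\<And>n. ?K n \<subseteq> R n" "\<And>n. R n \<subseteq> ?U"
    by metis
  have "?U \<subseteq> (\<Union>n. ?K n)"
  proof
    fix p assume "p \<in> ?U"
    then obtain n where "1 / real (Suc n) < f p - c"
      using reals_Archimedean[of "f p - c"] by (auto simp: inverse_eq_divide)
    then show "p \<in> (\<Union>n. ?K n)" by (intro UN_I[of n]) auto
  qed
  moreover have "(\<Union>n. ?K n) \<subseteq> (\<Union>n. R n)" "(\<Union>n. R n) \<subseteq> ?U"
    by (intro UN_mono UN_least R order_refl)+
  ultimately have "?U = (\<Union>n. R n)" by (meson subset_antisym subset_trans)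
  moreover have "(\<Union>n. R n) \<in> sets (borel \<Otimes>\<^sub>M borel)"
    using R(1) by (intro sets.countable_UN) auto
  ultimately show "{x \<in> space (borel \<Otimes>\<^sub>M borel). c < f x} \<in> sets (borel \<Otimes>\<^sub>M borel)"
    by (simp add: space_pair_measure)
qed

lemma compact_t2_Urysohn:
  fixes K L :: "'a::t2_space set"
  assumes "compact (UNIV :: 'a set)" "compact K" "compact L" "K \<inter> L = {}"
  obtains f :: "'a \<Rightarrow> real" where "continuous_on UNIV f" "\<And>x. 0 \<le> f x \<and> f x \<le> 1"
    "\<And>x. x \<in> L \<Longrightarrow> f x = 0" "\<And>x. x \<in> K \<Longrightarrow> f x = 1"
proof -
  have "Hausdorff_space (euclidean :: 'a topology)"
    unfolding Hausdorff_space_def using hausdorff by (auto simp: disjnt_def)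
  moreover have "compact_space (euclidean :: 'a topology)"
    using assms(1) by (simp add: compact_space_def)
  ultimately have "normal_space (euclidean :: 'a topology)"
    by (intro compact_Hausdorff_or_regular_imp_normal_space) auto
  moreover have "closedin euclidean L" "closedin euclidean K" "disjnt L K"
    using assms by (auto simp: compact_imp_closed disjnt_def)
  ultimately obtain f where f: "continuous_map euclidean (top_of_set {0..1::real}) f"
    "f ` L \<subseteq> {0}" "f ` K \<subseteq> {1}"
    using Urysohn_lemma[of euclidean L K 0 1] by auto
  have "continuous_on UNIV f" "\<And>x. f x \<in> {0..1}"
    using f(1) unfolding continuous_map_in_subtopology by auto
  then show thesis using f(2,3) by (intro that[of f]) auto
qed

lemma integral_translate:
  fixes f :: "'a::{topological_ab_group_add, t2_space} \<Rightarrow> real"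
  assumes "invariant_regular M" "f \<in> borel_measurable borel"
  shows "(\<integral>y. f (x + y) \<partial>M) = (\<integral>y. f y \<partial>M)"
proof -
  interpret finite_measure M using assms(1) by (rule invariant_regularD)
  note [simp] = invariant_regularD(2,3)[OF assms(1)]
  have meas: "(+) x \<in> measurable M borel"
    using borel_measurable_continuous_onI[of "(+) x"] by (simp cong: measurable_cong_sets add: continuous_intros)
  have "distr M borel ((+) x) = M"
  proof (rule measure_eqI)
    fix A assume "A \<in> sets (distr M borel ((+) x))"
    then show "emeasure (distr M borel ((+) x)) A = emeasure M A"
      using meas invariant_regularD(5)[OF assms(1), of A x] by (simp add: emeasure_distr emeasure_eq_measure)
  qed simp
  then show ?thesis
    using integral_distr[OF meas assms(2)] by simp
qed

text \<open>The difference between \<open>f\<close> and the indicator of \<open>B\<close> vanishes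
  on \<open>K\<close> and on \<open>L\<close> and is at most 1 elsewhere.\<close>

lemma integral_bounds_between_compacts:
  fixes f :: "'a::{topological_ab_group_add, t2_space} \<Rightarrow> real"
  assumes M: "invariant_regular M" and f: "f \<in> borel_measurable borel" "\<And>x. 0 \<le> f x \<and> f x \<le> 1"
    "\<And>x. x \<in> L \<Longrightarrow> f x = 0" "\<And>x. x \<in> K \<Longrightarrow> f x = 1"
    and sets: "B \<in> sets borel" "K \<in> sets borel" "L \<in> sets borel" "K \<subseteq> B" "L \<subseteq> - B"
  shows "\<bar>(\<integral>x. f x \<partial>M) - measure M B\<bar> \<le> measure M (B - K) + measure M (- B - L)"
proof -
  interpret finite_measure M using M by (rule invariant_regularD)
  note [simp] = invariant_regularD(2,3)[OF M]
  have fM: "f \<in> borel_measurable M" using f(1) by (simp cong: measurable_cong_sets)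
  have int: "integrable M f"
    using f(2) fM by (intro integrable_const_bound[of _ 1]) auto
  have ind: "integrable M (indicator A :: 'a \<Rightarrow> real)" if "A \<in> sets borel" for A
    using that by (intro integrable_real_indicator) (auto simp: less_top[symmetric])
  have "\<bar>(\<integral>x. f x \<partial>M) - measure M B\<bar> = \<bar>\<integral>x. f x - indicator B x \<partial>M\<bar>"
    using int ind[OF sets(1)] sets(1) by (subst Bochner_Integration.integral_diff) auto
  also have "\<dots> \<le> (\<integral>x. \<bar>f x - indicator B x\<bar> \<partial>M)" by (rule integral_abs_bound)
  also have "\<dots> \<le> (\<integral>x. indicator (B - K) x + indicator (- B - L) x \<partial>M)"
  proof (rule integral_mono)
    fix x
    show "\<bar>f x - indicator B x\<bar> \<le> indicator (B - K) x + indicator (- B - L) x"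
      using f(2)[of x] f(3,4)[of x] sets(4,5) by (auto simp: indicator_def)
  qed (use int ind sets in auto)
  also have "\<dots> = measure M (B - K) + measure M (- B - L)"
    using sets by (subst Bochner_Integration.integral_add) (auto intro!: ind)
  finally show ?thesis .
qed

text \<open>Fubini for \<open>f (x + y)\<close>: invariance makes the inner integral constant in
  either order. Continuity of \<open>f\<close> matters here, since for a general Borel function
  \<open>f (x + y)\<close> need not be measurable for the product \<sigma>-algebra.\<close>

lemma integral_invariant_unique:
  fixes f :: "'a::{topological_ab_group_add, t2_space} \<Rightarrow> real"
  assumes comp: "compact (UNIV :: 'a set)" and M: "invariant_regular M" and N: "invariant_regular N"
    and f: "continuous_on UNIV f" "\<And>x. 0 \<le> f x \<and> f x \<le> 1"
  shows "(\<integral>x. f x \<partial>M) * measure N UNIV = (\<integral>x. f x \<partial>N) * measure M UNIV"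
proof -
  interpret M: finite_measure M using M by (rule invariant_regularD)
  interpret N: finite_measure N using N by (rule invariant_regularD)
  interpret pair_sigma_finite M N ..
  interpret P: finite_measure "M \<Otimes>\<^sub>M N" by (rule finite_measure_pair_measure) unfold_locales
  note [simp] = invariant_regularD(2,3)[OF M] invariant_regularD(2,3)[OF N]
  have fb: "f \<in> borel_measurable borel" using f(1) by (rule borel_measurable_continuous_onI)
  have "(\<lambda>p. f (fst p + snd p)) \<in> borel_measurable (borel \<Otimes>\<^sub>M borel)"
    by (intro continuous_pair_measurable comp continuous_on_compose2[OF f(1)] continuous_intros) auto
  then have "(\<lambda>(x, y). f (x + y)) \<in> borel_measurable (M \<Otimes>\<^sub>M N)"
    by (simp add: case_prod_unfold cong: measurable_cong_sets sets_pair_measure_cong)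
  then have "integrable (M \<Otimes>\<^sub>M N) (\<lambda>(x, y). f (x + y))"
    using f(2) by (intro P.integrable_const_bound[of _ 1]) auto
  from Fubini_integral[OF this]
  have "(\<integral>y. (\<integral>x. f (y + x) \<partial>M) \<partial>N) = (\<integral>x. (\<integral>y. f (x + y) \<partial>N) \<partial>M)"
    by (simp add: add.commute)
  then show ?thesis
    by (simp add: integral_translate[OF M fb] integral_translate[OF N fb] mult.commute)
qed

text \<open>One Urysohn function approximates the indicator of \<open>B\<close> for both measures at
  once, which transfers the continuous case to Borel sets. The cross-multiplied form admits null
  measures.\<close>

lemma invariant_regular_unique:
  fixes M N :: "'a::{topological_ab_group_add, t2_space} measure"
  assumes comp: "compact (UNIV :: 'a set)" and M: "invariant_regular M" and N: "invariant_regular N"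
    and B: "B \<in> sets borel"
  shows "measure M B * measure N UNIV = measure N B * measure M UNIV"
proof -
  interpret M: finite_measure M using M by (rule invariant_regularD)
  interpret N: finite_measure N using N by (rule invariant_regularD)
  note [simp] = invariant_regularD(2,3)[OF M] invariant_regularD(2,3)[OF N]
  have both: "\<exists>K. compact K \<and> K \<subseteq> B \<and> measure M (B - K) < e \<and> measure N (B - K) < e"
    if e: "0 < e" and B: "B \<in> sets borel" for B :: "'a set" and e :: real
  proof -
    obtain K K' where K: "compact K" "K \<subseteq> B" "measure M (B - K) < e" "compact K'" "K' \<subseteq> B" "measure N (B - K') < e"
      using invariant_regularD(4)[OF M B e] invariant_regularD(4)[OF N B e] by blast
    have "measure M (B - (K \<union> K')) \<le> measure M (B - K)" "measure N (B - (K \<union> K')) \<le> measure N (B - K')"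
      using K B by (auto intro!: M.finite_measure_mono N.finite_measure_mono simp: borel_compact)
    then show ?thesis using K by (intro exI[of _ "K \<union> K'"]) (auto simp: compact_Un)
  qed
  let ?c = "measure N UNIV + measure M UNIV"
  have "\<bar>measure M B * measure N UNIV - measure N B * measure M UNIV\<bar> \<le> 0 + e" if "0 < e" for e :: real
  proof -
    define c where "c = ?c"
    \<comment> \<open>The summand 1 keeps the denominator positive when both measures
      vanish.\<close>
    define d where "d = e / (2 * (c + 1))"
    have c: "0 \<le> c" by (simp add: c_def add_nonneg_nonneg)
    then have "0 < d" "2 * d * c \<le> e"
      using that by (simp_all add: d_def field_simps)
    then have d: "0 < d" "2 * d * ?c \<le> e" by (simp_all add: c_def)
    obtain K where K: "compact K" "K \<subseteq> B" "measure M (B - K) < d" "measure N (B - K) < d"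
      using both[OF d(1) B] by blast
    obtain L where L: "compact L" "L \<subseteq> - B" "measure M (- B - L) < d" "measure N (- B - L) < d"
      using both[OF d(1), of "- B"] B by auto
    obtain f :: "'a \<Rightarrow> real" where f: "continuous_on UNIV f" "\<And>x. 0 \<le> f x \<and> f x \<le> 1"
      "\<And>x. x \<in> L \<Longrightarrow> f x = 0" "\<And>x. x \<in> K \<Longrightarrow> f x = 1"
      using compact_t2_Urysohn[OF comp K(1) L(1)] K(2) L(2) by blast
    note fb = borel_measurable_continuous_onI[OF f(1)]
    have KL: "K \<in> sets borel" "L \<in> sets borel" using K L by (auto intro: borel_compact)
    have "\<bar>(\<integral>x. f x \<partial>M) - measure M B\<bar> \<le> 2 * d" "\<bar>(\<integral>x. f x \<partial>N) - measure N B\<bar> \<le> 2 * d"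
      using integral_bounds_between_compacts[OF M fb f(2-4) B KL K(2) L(2)]
        integral_bounds_between_compacts[OF N fb f(2-4) B KL K(2) L(2)] K L by linarith+
    then have "\<bar>(\<integral>x. f x \<partial>M) - measure M B\<bar> * measure N UNIV \<le> 2 * d * measure N UNIV"
      "\<bar>(\<integral>x. f x \<partial>N) - measure N B\<bar> * measure M UNIV \<le> 2 * d * measure M UNIV"
      by (auto intro!: mult_right_mono)
    then have "\<bar>(\<integral>x. f x \<partial>M) * measure N UNIV - measure M B * measure N UNIV\<bar> \<le> 2 * d * measure N UNIV"
      "\<bar>(\<integral>x. f x \<partial>N) * measure M UNIV - measure N B * measure M UNIV\<bar> \<le> 2 * d * measure M UNIV"
      by (simp_all add: abs_mult left_diff_distrib[symmetric])
    then show ?thesis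
      using integral_invariant_unique[OF comp M N f(1,2)] d(2) by (simp add: distrib_left)
  qed
  then show ?thesis using field_le_epsilon[of "\<bar>measure M B * measure N UNIV - measure N B * measure M UNIV\<bar>" 0] by simp
qed

section \<open>Slices and the Haar measure of rectangles\<close>

text \<open>Translation by \<open>(g, 0)\<close> preserves both \<open>M\<close> and the slab over
  \<open>D\<close>, so the slice is invariant; projections of compact sets make it regular.\<close>

lemma invariant_regular_slice:
  fixes M :: "('a::{topological_ab_group_add, t2_space} \<times> 'b::{topological_ab_group_add, t2_space}) measure"
  assumes M: "invariant_regular M" and D: "D \<in> sets borel"
  shows "invariant_regular (distr (density M (indicator (snd -` D))) borel fst)" (is "invariant_regular ?N")
    and "\<And>A. A \<in> sets borel \<Longrightarrow>
      measure (distr (density M (indicator (snd -` D))) borel fst) A = measure M (A \<times> D)"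
proof -
  interpret finite_measure M using M by (rule invariant_regularD)
  note [simp] = invariant_regularD(2,3)[OF M]
  have fst_borel: "fst -` A \<in> sets (borel :: ('a \<times> 'b) measure)" if "A \<in> sets borel" for A :: "'a set"
    by (rule vimage_borel[OF _ that]) (intro continuous_intros)
  have snd_borel: "snd -` D \<in> sets (borel :: ('a \<times> 'b) measure)"
    by (rule vimage_borel[OF _ D]) (intro continuous_intros)
  have fst_meas: "fst \<in> measurable (density M (indicator (snd -` D))) borel"
    using borel_measurable_continuous_onI[of "fst :: 'a \<times> 'b \<Rightarrow> 'a"]
    by (simp add: continuous_intros cong: measurable_cong_sets)
  show m: "measure ?N A = measure M (A \<times> D)" if "A \<in> sets borel" for A
  proof -
    have "snd -` D \<inter> fst -` A = A \<times> D" by auto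
    then show ?thesis
      using fst_meas that snd_borel fst_borel[OF that] by (simp add: measure_distr measure_restricted)
  qed
  interpret N: finite_measure ?N
    by (intro finite_measure.finite_measure_distr finite_measure_restricted fst_meas) (simp add: snd_borel)
  have rect: "A \<times> D \<in> sets borel" if "A \<in> sets borel" for A :: "'a set"
  proof -
    have "A \<times> D = fst -` A \<inter> snd -` D" by auto
    then show ?thesis using fst_borel[OF that] snd_borel by simp
  qed
  show "invariant_regular ?N"
    unfolding invariant_regular_def
  proof (intro conjI ballI allI impI)
    show "finite_measure ?N" by (rule N.finite_measure_axioms)
    show "sets ?N = sets borel" by simp
  next
    fix B :: "'a set" and e :: real assume B: "B \<in> sets borel" and e: "0 < e"
    obtain K where K: "compact K" "K \<subseteq> fst -` B" "measure M (fst -` B - K) < e"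
      using invariant_regularD(4)[OF M fst_borel[OF B] e] by blast
    have fK: "compact (fst ` K)"
      by (rule compact_continuous_image[OF _ K(1)]) (intro continuous_intros)
    then have BK: "B - fst ` K \<in> sets borel" using B by (auto intro: borel_compact)
    have "measure M ((B - fst ` K) \<times> D) \<le> measure M (fst -` B - K)"
      using borel_compact[OF K(1)] fst_borel[OF B] by (intro finite_measure_mono) force+
    then show "\<exists>K. compact K \<and> K \<subseteq> B \<and> measure ?N (B - K) < e"
      using K fK m[OF BK] by (intro exI[of _ "fst ` K"]) auto
  next
    fix g and B :: "'a set" assume B: "B \<in> sets borel"
    have gB: "(+) g -` B \<in> sets borel" by (intro vimage_borel B continuous_intros)
    have "((+) g -` B) \<times> D = (+) (g, 0) -` (B \<times> D)" by auto
    then show "measure ?N ((+) g -` B) = measure ?N B"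
      using invariant_regularD(5)[OF M rect[OF B], of "(g, 0)"] by (simp add: m B gB)
  qed
qed

definition haar_like :: "'a::{topological_ab_group_add, t2_space} measure \<Rightarrow> bool" where
  "haar_like M \<longleftrightarrow> invariant_regular M \<and> measure M UNIV = 1"

lemma haar_like_haar:
  fixes M :: "'a::{topological_ab_group_add, t2_space} measure"
  assumes "compact (UNIV :: 'a set)" "haar_prob_measure M"
  shows "haar_like M"
proof -
  interpret prob_space M using assms(2) by (simp add: haar_prob_measure_def)
  show ?thesis
    using haar_invariant_regular[OF assms(2,1)] prob_space invariant_regularD(3)[of M]
    by (simp add: haar_like_def)
qed

lemma haar_like_distr:
  fixes f :: "'a::{topological_ab_group_add, t2_space} \<Rightarrow> 'b::{topological_ab_group_add, t2_space}"
  assumes M: "haar_like M" and f: "continuous_on UNIV f" "\<And>x y. f (x + y) = f x + f y" "surj f"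
  shows "haar_like (distr M borel f)"
    and "\<And>B. B \<in> sets borel \<Longrightarrow> measure (distr M borel f) B = measure M (f -` B)"
proof -
  have M': "invariant_regular M" using M by (simp add: haar_like_def)
  note [simp] = invariant_regularD(2,3)[OF M']
  have "f \<in> measurable M borel"
    using borel_measurable_continuous_onI[OF f(1)] by (simp cong: measurable_cong_sets)
  then show m: "measure (distr M borel f) B = measure M (f -` B)" if "B \<in> sets borel" for B
    using that by (simp add: measure_distr)
  show "haar_like (distr M borel f)"
    using M m[of UNIV] invariant_regular_distr[OF M' f] by (simp add: haar_like_def)
qed

lemma haar_like_unique:
  fixes M N :: "'a::{topological_ab_group_add, t2_space} measure"
  assumes "compact (UNIV :: 'a set)" "haar_like M" "haar_like N" "B \<in> sets borel"
  shows "measure M B = measure N B"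
  using invariant_regular_unique[OF assms(1) _ _ assms(4), of M N] assms(2,3) by (simp add: haar_like_def)

lemma haar_like_vimage:
  fixes M :: "'a::{topological_ab_group_add, t2_space} measure"
    and N :: "'b::{topological_ab_group_add, t2_space} measure"
  assumes "compact (UNIV :: 'b set)" "haar_like M" "haar_like N"
    and f: "continuous_on UNIV f" "\<And>x y. f (x + y) = f x + f y" "surj f" and B: "B \<in> sets borel"
  shows "measure M (f -` B) = measure N B"
  using haar_like_distr[OF assms(2) f] haar_like_unique[OF assms(1) _ assms(3) B] B by metis

text \<open>For fixed \<open>D\<close> the slice is a multiple of \<open>N\<close> by uniqueness.
  The factor is read off at \<open>A = UNIV\<close>, where the image of \<open>M\<close> under
  \<open>snd\<close> is Haar measure.\<close>

lemma haar_like_Times: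
  fixes M :: "('a::{topological_ab_group_add, t2_space} \<times> 'b::{topological_ab_group_add, t2_space}) measure"
  assumes comp: "compact (UNIV :: 'a set)" "compact (UNIV :: 'b set)"
    and M: "haar_like M" and N: "haar_like N" and N': "haar_like N'"
    and A: "A \<in> sets borel" and D: "D \<in> sets borel"
  shows "measure M (A \<times> D) = measure N A * measure N' D"
proof -
  let ?S = "distr (density M (indicator (snd -` D))) borel fst"
  have M': "invariant_regular M" and N1: "invariant_regular N" "measure N UNIV = 1"
    using M N by (auto simp: haar_like_def)
  note slice = invariant_regular_slice[OF M' D]
  have "snd -` D = (UNIV :: 'a set) \<times> D" by auto
  then have "measure M (UNIV \<times> D) = measure N' D"
    using haar_like_vimage[OF comp(2) M N' _ _ _ D, of snd] by (simp add: continuous_intros)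
  moreover have "measure ?S A * measure N UNIV = measure N A * measure ?S UNIV"
    by (rule invariant_regular_unique[OF comp(1) slice(1) N1(1) A])
  ultimately show ?thesis using slice(2)[OF A] slice(2)[of UNIV] N1(2) by simp
qed

section \<open>Atoms and approximation by rectangles\<close>

lemma (in finite_measure) measure_split:
  assumes "finite J" "S \<in> sets M" "\<And>j. j \<in> J \<Longrightarrow> \<psi> -` {j} \<inter> space M \<in> sets M" "\<psi> ` space M \<subseteq> J"
  shows "measure M S = (\<Sum>j\<in>J. measure M (S \<inter> \<psi> -` {j}))"
proof -
  have sub: "S \<subseteq> space M" using assms(2) by (rule sets.sets_into_space)
  then have "S = (\<Union>j\<in>J. S \<inter> \<psi> -` {j})" using assms(4) by auto
  moreover have "S \<inter> \<psi> -` {j} \<in> sets M" if "j \<in> J" for j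
  proof -
    have "S \<inter> \<psi> -` {j} = S \<inter> (\<psi> -` {j} \<inter> space M)" using sub by auto
    then show ?thesis using assms(2,3) that by simp
  qed
  ultimately show ?thesis
    using finite_measure_finite_Union[OF assms(1), of "\<lambda>j. S \<inter> \<psi> -` {j}"]
    by (auto simp: disjoint_family_on_def)
qed

text \<open>An atom of the finite algebra generated by \<open>\<U>\<close> is encoded as the set of members of \<open>\<U>\<close> containing it.\<close>

definition atom_of :: "'a set set \<Rightarrow> 'a \<Rightarrow> 'a set set" where
  "atom_of \<U> x = {U \<in> \<U>. x \<in> U}"

lemma atom_of_in_Pow: "atom_of \<U> x \<in> Pow \<U>"
  by (auto simp: atom_of_def)

lemma atom_of_vimage_borel:
  assumes "finite \<U>" "\<And>U. U \<in> \<U> \<Longrightarrow> open U" "continuous_on UNIV f"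
  shows "{p. atom_of \<U> (f p) = s} \<in> sets borel"
proof (cases "s \<subseteq> \<U>")
  case True
  have "{p. atom_of \<U> (f p) = s} = {p \<in> space borel. \<forall>U\<in>\<U>. f p \<in> (if U \<in> s then U else - U)}"
    using True by (auto simp: atom_of_def)
  also have "\<dots> \<in> sets borel"
  proof (rule sets.sets_Collect_finite_All)
    fix U assume "U \<in> \<U>"
    then have "f -` (if U \<in> s then U else - U) \<in> sets borel"
      using borel_open[OF assms(2)] by (intro vimage_borel assms(3)) auto
    then show "{p \<in> space borel. f p \<in> (if U \<in> s then U else - U)} \<in> sets borel"
      by (simp add: vimage_def)
  qed (rule assms(1))
  finally show ?thesis .
next
  case False
  then have "{p. atom_of \<U> (f p) = s} = {}" by (auto simp: atom_of_def)
  then show ?thesis by simp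
qed

text \<open>Applied on G^2 it identifies the coupled mass, and on G^3 the triangle sum, with the
  measure of an event.\<close>

lemma measure_atoms:
  fixes M :: "'c::topological_space measure" and a b c :: "'c \<Rightarrow> 'a::topological_space"
  assumes "finite_measure M" "sets M = sets borel" "finite \<U>" "\<And>U. U \<in> \<U> \<Longrightarrow> open U"
    and cont: "continuous_on UNIV a" "continuous_on UNIV b" "continuous_on UNIV c"
  shows "measure M {p. Q (atom_of \<U> (a p)) (atom_of \<U> (b p)) (atom_of \<U> (c p))} =
    (\<Sum>s\<in>Pow \<U>. \<Sum>t\<in>Pow \<U>. \<Sum>u\<in>Pow \<U>.
      measure M {p. atom_of \<U> (a p) = s \<and> atom_of \<U> (b p) = t \<and> atom_of \<U> (c p) = u} * of_bool (Q s t u))"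
proof -
  interpret finite_measure M by (rule assms)
  let ?V = "Pow \<U>"
  define cell where "cell j = {p. atom_of \<U> (a p) = fst j \<and> atom_of \<U> (b p) = fst (snd j) \<and>
    atom_of \<U> (c p) = snd (snd j)}" for j
  define q where "q j \<longleftrightarrow> Q (fst j) (fst (snd j)) (snd (snd j))" for j
  have cell: "cell j \<in> sets M" for j
  proof -
    have "cell j = {p. atom_of \<U> (a p) = fst j} \<inter> ({p. atom_of \<U> (b p) = fst (snd j)} \<inter>
      {p. atom_of \<U> (c p) = snd (snd j)})" by (auto simp: cell_def)
    then show ?thesis
      using assms(2-4) cont by (simp add: sets.Int atom_of_vimage_borel)
  qed
  let ?J = "{j \<in> ?V \<times> ?V \<times> ?V. q j}"
  have "{p. Q (atom_of \<U> (a p)) (atom_of \<U> (b p)) (atom_of \<U> (c p))} = (\<Union>j\<in>?J. cell j)"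
    using atom_of_in_Pow[of \<U>] by (auto simp del: Pow_iff simp: cell_def q_def)
  then have "measure M {p. Q (atom_of \<U> (a p)) (atom_of \<U> (b p)) (atom_of \<U> (c p))} =
      (\<Sum>j\<in>?J. measure M (cell j))"
    using cell assms(3) by (subst finite_measure_finite_Union[symmetric])
      (auto simp: disjoint_family_on_def cell_def prod_eq_iff)
  also have "\<dots> = (\<Sum>j\<in>?V \<times> ?V \<times> ?V. measure M (cell j) * of_bool (q j))"
    using assms(3) by (intro sum.mono_neutral_cong_left) auto
  also have "\<dots> = (\<Sum>s\<in>?V. \<Sum>t\<in>?V. \<Sum>u\<in>?V. measure M (cell (s, t, u)) * of_bool (q (s, t, u)))"
    by (simp add: sum.cartesian_product case_prod_unfold)
  finally show ?thesis by (simp add: cell_def q_def)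
qed

text \<open>A compact set inside \<open>E\<close> and one inside its complement leave room for a
  finite union of open rectangles that contains the first and avoids the second, which controls both
  differences.\<close>

lemma rectangle_approx:
  fixes M :: "('a::{topological_ab_group_add, t2_space} \<times> 'b::{topological_ab_group_add, t2_space}) measure"
  assumes M: "invariant_regular M" and E: "E \<in> sets borel" and e: "0 < e"
  obtains S where "finite S" "\<forall>(A, B)\<in>S. open A \<and> open B"
    "measure M (E - (\<Union>(A, B)\<in>S. A \<times> B)) < e" "measure M ((\<Union>(A, B)\<in>S. A \<times> B) - E) < e"
proof -
  interpret finite_measure M using M by (rule invariant_regularD)
  note [simp] = invariant_regularD(2,3)[OF M]
  obtain K where K: "compact K" "K \<subseteq> E" "measure M (E - K) < e"
    using invariant_regularD(4)[OF M E e] by blast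
  obtain L where L: "compact L" "L \<subseteq> - E" "measure M (- E - L) < e"
    using invariant_regularD(4)[OF M _ e, of "- E"] E by auto
  have "open (- L)" "K \<subseteq> - L" using L K compact_imp_closed[OF L(1)] by auto
  then obtain S where S: "finite S" "\<forall>(A, B)\<in>S. open A \<and> open B"
    "K \<subseteq> (\<Union>(A, B)\<in>S. A \<times> B)" "(\<Union>(A, B)\<in>S. A \<times> B) \<subseteq> - L"
    using open_union_of_rectangles[OF K(1), of "- L"] by metis
  have "measure M (E - (\<Union>(A, B)\<in>S. A \<times> B)) \<le> measure M (E - K)"
    "measure M ((\<Union>(A, B)\<in>S. A \<times> B) - E) \<le> measure M (- E - L)"
    using S(3,4) E K(1) L(1) by (intro finite_measure_mono; force intro: borel_compact)+
  then show thesis using S K L by (intro that[of S]) auto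
qed

section \<open>Corners\<close>

lemma (in finite_measure) measure_Un4_le:
  assumes "A \<in> sets M" "B \<in> sets M" "C \<in> sets M" "D \<in> sets M"
    and "measure M B \<le> b" "measure M C \<le> c" "measure M D \<le> d"
  shows "measure M (A \<union> (B \<union> (C \<union> D))) \<le> measure M A + (b + (c + d))"
proof -
  have "measure M (A \<union> (B \<union> (C \<union> D))) \<le> measure M A + (measure M B + (measure M C + measure M D))"
    using assms(1-4) by (intro order_trans[OF measure_Un_le] add_left_mono sets.Un order_refl)
  then show ?thesis using assms(5-7) by linarith
qed

lemma corner_sets:
  fixes m2 :: "('a::{topological_ab_group_add, t2_space} \<times> 'a) measure"
    and m3 :: "('a \<times> 'a \<times> 'a) measure"
  assumes comp: "compact (UNIV :: 'a set)" and m2: "haar_like m2" and m3: "haar_like m3" and "0 < \<epsilon>"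
  shows "\<exists>\<delta>>0. \<forall>E\<in>sets borel. \<epsilon> \<le> measure m2 E \<longrightarrow>
    \<delta> \<le> measure m3 {(x, y, t). (x, y) \<in> E \<and> (x + t, y) \<in> E \<and> (x, y + t) \<in> E}"
proof -
  have comp2: "compact (UNIV :: ('a \<times> 'a) set)"
    using compact_Times[OF comp comp] by simp
  have comp3: "compact (UNIV :: ('a \<times> 'a \<times> 'a) set)"
    using compact_Times[OF comp comp2] by simp
  have reg2: "invariant_regular m2" and reg3: "invariant_regular m3"
    using m2 m3 by (auto simp: haar_like_def)
  interpret M2: finite_measure m2 using reg2 by (rule invariant_regularD)
  interpret M3: finite_measure m3 using reg3 by (rule invariant_regularD)
  note [simp] = invariant_regularD(2,3)[OF reg2] invariant_regularD(2,3)[OF reg3]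
  \<comment> \<open>The Haar measure on G itself is obtained as a marginal of
    \<open>m2\<close>.\<close>
  define m where "m = distr m2 borel fst"
  have m: "haar_like m"
    unfolding m_def by (intro haar_like_distr(1)[OF m2]) (auto intro: continuous_intros)
  then have regm: "invariant_regular m" by (simp add: haar_like_def)
  interpret M: finite_measure m using regm by (rule invariant_regularD)
  note [simp] = invariant_regularD(2,3)[OF regm]
  \<comment> \<open>Lower case maps read edges off the degenerate triangle z = x + y, capitals off z
    = x + y + t. All are continuous surjective homomorphisms and hence carry Haar measure to Haar
    measure; for \<open>yz\<close> and \<open>xz\<close> this gives the independence of the
    pairs.\<close>
  define yz where "yz p = (snd p, fst p + snd p)" for p :: "'a \<times> 'a"
  define xz where "xz p = (fst p, fst p + snd p)" for p :: "'a \<times> 'a"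
  define XYZ where "XYZ p = (fst p, fst (snd p), fst p + fst (snd p) + snd (snd p))" for p :: "'a \<times> 'a \<times> 'a"
  define XY where "XY p = (fst p, fst (snd p))" for p :: "'a \<times> 'a \<times> 'a"
  define YZ where "YZ p = (fst (snd p), fst p + fst (snd p) + snd (snd p))" for p :: "'a \<times> 'a \<times> 'a"
  define XZ where "XZ p = (fst p, fst p + fst (snd p) + snd (snd p))" for p :: "'a \<times> 'a \<times> 'a"
  have cont: "continuous_on UNIV yz" "continuous_on UNIV xz" "continuous_on UNIV XYZ"
    "continuous_on UNIV XY" "continuous_on UNIV YZ" "continuous_on UNIV XZ"
    unfolding yz_def xz_def XYZ_def XY_def YZ_def XZ_def by (intro continuous_intros)+
  have surj: "surj yz" "surj xz" "surj XYZ" "surj XY" "surj YZ" "surj XZ"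
    by (rule surjI[of _ "\<lambda>(y, z). (z - y, y)"], simp add: yz_def case_prod_unfold)
       (rule surjI[of _ "\<lambda>(x, z). (x, z - x)"], simp add: xz_def case_prod_unfold,
        rule surjI[of _ "\<lambda>(x, y, z). (x, y, z - x - y)"], simp add: XYZ_def case_prod_unfold,
        rule surjI[of _ "\<lambda>(x, y). (x, y, 0)"], simp add: XY_def case_prod_unfold,
        rule surjI[of _ "\<lambda>(y, z). (z - y, y, 0)"], simp add: YZ_def case_prod_unfold,
        rule surjI[of _ "\<lambda>(x, z). (x, z - x, 0)"], simp add: XZ_def case_prod_unfold)
  have add: "yz (p + p') = yz p + yz p'" "xz (p + p') = xz p + xz p'" "XYZ (q + q') = XYZ q + XYZ q'"
    "XY (q + q') = XY q + XY q'" "YZ (q + q') = YZ q + YZ q'" "XZ (q + q') = XZ q + XZ q'" for p p' q q'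
    by (simp_all add: yz_def xz_def XYZ_def XY_def YZ_def XZ_def add_ac)
  have push: "measure m2 (yz -` B) = measure m2 B" "measure m2 (xz -` B) = measure m2 B"
    "measure m3 (XY -` B) = measure m2 B" "measure m3 (YZ -` B) = measure m2 B"
    "measure m3 (XZ -` B) = measure m2 B" if "B \<in> sets borel" for B
    using haar_like_vimage[OF comp2 m2 m2 cont(1) add(1) surj(1) that]
      haar_like_vimage[OF comp2 m2 m2 cont(2) add(2) surj(2) that]
      haar_like_vimage[OF comp2 m3 m2 cont(4) add(4) surj(4) that]
      haar_like_vimage[OF comp2 m3 m2 cont(5) add(5) surj(5) that]
      haar_like_vimage[OF comp2 m3 m2 cont(6) add(6) surj(6) that] by auto
  have push3: "measure m3 (XYZ -` B) = measure m3 B" if "B \<in> sets borel" for B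
    by (rule haar_like_vimage[OF comp3 m3 m3 cont(3) add(3) surj(3) that])
  have rect: "A \<times> B \<in> sets borel" if "A \<in> sets borel" "B \<in> sets borel"
    for A :: "'c::topological_space set" and B :: "'d::topological_space set"
  proof -
    have "A \<times> B = fst -` A \<inter> snd -` B" by auto
    moreover have "fst -` A \<in> sets (borel :: ('c \<times> 'd) measure)" "snd -` B \<in> sets (borel :: ('c \<times> 'd) measure)"
      by (rule vimage_borel; auto intro: continuous_intros that)+
    ultimately show ?thesis by simp
  qed
  have prod2: "measure m2 (A \<times> B) = measure m A * measure m B"
    if "A \<in> sets borel" "B \<in> sets borel" for A B
    by (rule haar_like_Times[OF comp comp m2 m m that])
  have prod3: "measure m3 (A \<times> B \<times> C) = measure m A * measure m B * measure m C"
    if "A \<in> sets borel" "B \<in> sets borel" "C \<in> sets borel" for A B C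
    using haar_like_Times[OF comp comp2 m3 m m2 that(1) rect[OF that(2,3)]] prod2[OF that(2,3)] by simp
  obtain \<delta> :: real where \<delta>: "0 < \<delta>"
    "\<forall>(V :: 'a set set set) w \<rho> A B C.
      coupling V w \<rho> \<longrightarrow> unit_valued A \<longrightarrow> unit_valued B \<longrightarrow> unit_valued C \<longrightarrow>
      \<epsilon> / 2 \<le> coupling.coupled V \<rho> (\<lambda>x y z. A x y * B y z * C x z) \<longrightarrow>
      \<delta> \<le> weighted_set.triangles V w A B C"
    using coupled_triangle_removal[where 'b = "'a set set", OF half_gt_zero[OF assms(4)]] by auto
  \<comment> \<open>The three graphs are approximated twice over: missing points cost at most half
    of \<open>\<epsilon>\<close> in \<open>m2\<close>, surplus points at most half of
    \<open>\<delta>\<close> in \<open>m3\<close>.\<close>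
  define e where "e = min (\<epsilon> / 6) (\<delta> / 6)"
  have e: "0 < e" "3 * e \<le> \<epsilon> / 2" "3 * e \<le> \<delta> / 2" using \<delta>(1) assms(4) by (auto simp: e_def)
  show ?thesis
  proof (intro exI[of _ "\<delta> / 2"] conjI ballI impI)
    show "0 < \<delta> / 2" using \<delta>(1) by simp
    fix E :: "('a \<times> 'a) set" assume E: "E \<in> sets borel" and large: "\<epsilon> \<le> measure m2 E"
    \<comment> \<open>For z = x + y + t these say (x + t, y) \<in> E in the coordinates (y, z), and
      (x, y + t) \<in> E in the coordinates (x, z).\<close>
    define E2 where "E2 = (\<lambda>p. (snd p - fst p, fst p)) -` E"
    define E3 where "E3 = (\<lambda>p. (fst p, snd p - fst p)) -` E"
    have sets: "E2 \<in> sets borel" "E3 \<in> sets borel"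
      unfolding E2_def E3_def by (intro vimage_borel E continuous_intros)+
    define R where "R S = (\<Union>(A, B)\<in>S. A \<times> B)" for S :: "('a set \<times> 'a set) set"
    obtain S1 where S1: "finite S1" "\<forall>(A, B)\<in>S1. open A \<and> open B"
      "measure m2 (E - R S1) < e" "measure m2 (R S1 - E) < e"
      by (rule rectangle_approx[OF reg2 E e(1), folded R_def])
    obtain S2 where S2: "finite S2" "\<forall>(A, B)\<in>S2. open A \<and> open B"
      "measure m2 (E2 - R S2) < e" "measure m2 (R S2 - E2) < e"
      by (rule rectangle_approx[OF reg2 sets(1) e(1), folded R_def])
    obtain S3 where S3: "finite S3" "\<forall>(A, B)\<in>S3. open A \<and> open B"
      "measure m2 (E3 - R S3) < e" "measure m2 (R S3 - E3) < e"
      by (rule rectangle_approx[OF reg2 sets(2) e(1), folded R_def])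
    have R_borel: "R S \<in> sets borel" if "finite S" "\<forall>(A, B)\<in>S. open A \<and> open B" for S
      unfolding R_def using that by (intro borel_open open_UN) (auto intro: open_Times)
    note R_borel = R_borel[OF S1(1,2)] R_borel[OF S2(1,2)] R_borel[OF S3(1,2)]
    \<comment> \<open>Taking all sides of all rectangles makes membership in each approximant a
      function of the atoms of the two coordinates. The atoms become the vertices.\<close>
    define \<U> where "\<U> = fst ` (S1 \<union> S2 \<union> S3) \<union> snd ` (S1 \<union> S2 \<union> S3)"
    have \<U>: "finite \<U>" "\<And>U. U \<in> \<U> \<Longrightarrow> open U"
      using S1(1,2) S2(1,2) S3(1,2) by (auto simp: \<U>_def)
    define \<phi> where "\<phi> = atom_of \<U>"
    define P where "P S s t \<longleftrightarrow> (\<exists>(A, B)\<in>S. A \<in> s \<and> B \<in> t)" for S :: "('a set \<times> 'a set) set" and s t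
    have sub: "S1 \<subseteq> S1 \<union> S2 \<union> S3" "S2 \<subseteq> S1 \<union> S2 \<union> S3" "S3 \<subseteq> S1 \<union> S2 \<union> S3" by auto
    have R_iff: "(x, y) \<in> R S \<longleftrightarrow> P S (\<phi> x) (\<phi> y)" if "S \<subseteq> S1 \<union> S2 \<union> S3" for S x y
    proof -
      have mem: "fst q \<in> \<U>" "snd q \<in> \<U>" if "q \<in> S" for q
        using that \<open>S \<subseteq> _\<close> unfolding \<U>_def by blast+
      have "(x, y) \<in> R S \<longleftrightarrow> (\<exists>q\<in>S. x \<in> fst q \<and> y \<in> snd q)"
        by (simp add: R_def case_prod_unfold mem_Times_iff)
      also have "\<dots> \<longleftrightarrow> (\<exists>q\<in>S. fst q \<in> \<phi> x \<and> snd q \<in> \<phi> y)"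
        using mem by (intro bex_cong refl) (simp add: \<phi>_def atom_of_def)
      finally show ?thesis by (simp add: P_def case_prod_unfold)
    qed
    define w where "w s = measure m {x. \<phi> x = s}" for s
    \<comment> \<open>The law of the atoms of (x, y, x + y), that is, of the degenerate
      triangles.\<close>
    define \<rho> where "\<rho> s t u = measure m2 {p. \<phi> (fst p) = s \<and> \<phi> (snd p) = t \<and> \<phi> (fst p + snd p) = u}" for s t u
    have atom: "{p. \<phi> (f p) = s} \<in> sets borel" if "continuous_on UNIV f" for f :: "'c::topological_space \<Rightarrow> 'a" and s
      unfolding \<phi>_def by (rule atom_of_vimage_borel[OF \<U> that])
    have atom1: "{x. \<phi> x = s} \<in> sets borel" for s
      using atom[of "\<lambda>x. x"] by simp
    have \<phi>_in: "\<phi> x \<in> Pow \<U>" for x unfolding \<phi>_def by (rule atom_of_in_Pow)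
    have pair: "measure m2 {p. \<phi> (fst p) = s \<and> \<phi> (snd p) = t} = w s * w t" for s t
    proof -
      have "{p. \<phi> (fst p) = s \<and> \<phi> (snd p) = t} = {x. \<phi> x = s} \<times> {x. \<phi> x = t}" by auto
      then show ?thesis unfolding w_def using prod2[OF atom1 atom1] by simp
    qed
    have pair_borel: "{p. \<phi> (f p) = s \<and> \<phi> (g p) = t} \<in> sets borel"
      if "continuous_on UNIV f" "continuous_on UNIV g" for f g :: "'c::topological_space \<Rightarrow> 'a" and s t
      using sets.Int[OF atom[OF that(1), of s] atom[OF that(2), of t]] by (simp add: Collect_conj_eq)
    have split: "(\<Sum>u\<in>Pow \<U>. measure m2 ({p. \<phi> (f p) = s \<and> \<phi> (g p) = t} \<inter> (\<lambda>p. \<phi> (h p)) -` {u})) =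
        measure m2 {p. \<phi> (f p) = s \<and> \<phi> (g p) = t}"
      if "continuous_on UNIV f" "continuous_on UNIV g" "continuous_on UNIV h" for f g h :: "'a \<times> 'a \<Rightarrow> 'a" and s t
      using \<U>(1) pair_borel[OF that(1,2)] atom[OF that(3)] \<phi>_in
      by (intro M2.measure_split[symmetric]) (simp_all add: vimage_def image_subset_iff)
    interpret W: coupling "Pow \<U>" w \<rho>
    proof
      show "finite (Pow \<U>)" using \<U> by simp
      show "0 \<le> w x" for x by (simp add: w_def)
      show "0 \<le> \<rho> x y z" for x y z by (simp add: \<rho>_def)
      have "measure m UNIV = (\<Sum>s\<in>Pow \<U>. measure m (UNIV \<inter> \<phi> -` {s}))"
        using \<U>(1) atom1 \<phi>_in by (intro M.measure_split) (simp_all add: vimage_def image_subset_iff)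
      then show "(\<Sum>x\<in>Pow \<U>. w x) = 1"
        using m by (simp add: w_def haar_like_def vimage_def)
      show "(\<Sum>u\<in>Pow \<U>. \<rho> s t u) = w s * w t" for s t
        using split[of fst snd "\<lambda>p. fst p + snd p" s t] pair[of s t]
        by (simp add: \<rho>_def continuous_intros Int_def conj_assoc)
      show "(\<Sum>s\<in>Pow \<U>. \<rho> s t u) = w t * w u" for t u
      proof -
        have "measure m2 (yz -` {p. \<phi> (fst p) = t \<and> \<phi> (snd p) = u}) = w t * w u"
          unfolding pair[symmetric] by (intro push(1) pair_borel continuous_intros)
        then show ?thesis
          using split[of snd "\<lambda>p. fst p + snd p" fst t u]
          by (simp add: \<rho>_def yz_def continuous_intros Int_def conj_ac vimage_def)
      qed
      show "(\<Sum>t\<in>Pow \<U>. \<rho> s t u) = w s * w u" for s u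
      proof -
        have "measure m2 (xz -` {p. \<phi> (fst p) = s \<and> \<phi> (snd p) = u}) = w s * w u"
          unfolding pair[symmetric] by (intro push(2) pair_borel continuous_intros)
        then show ?thesis
          using split[of fst "\<lambda>p. fst p + snd p" snd s u]
          by (simp add: \<rho>_def xz_def continuous_intros Int_def conj_ac vimage_def)
      qed
    qed
    define A where "A s t = (of_bool (P S1 s t) :: real)" for s t
    define B where "B s t = (of_bool (P S2 s t) :: real)" for s t
    define C where "C s t = (of_bool (P S3 s t) :: real)" for s t
    define Q where "Q s t u \<longleftrightarrow> P S1 s t \<and> P S2 t u \<and> P S3 s u" for s t u
    have ABC: "A s t * B t u * C s u = of_bool (Q s t u)" for s t u
      by (simp add: A_def B_def C_def Q_def)
    have unit: "unit_valued A" "unit_valued B" "unit_valued C"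
      by (auto simp: unit_valued_def A_def B_def C_def)
    have diff_borel: "E - R S1 \<in> sets borel" "E2 - R S2 \<in> sets borel" "E3 - R S3 \<in> sets borel"
      "R S1 - E \<in> sets borel" "R S2 - E2 \<in> sets borel" "R S3 - E3 \<in> sets borel"
      using E sets R_borel by auto
    note diff_borel = diff_borel diff_borel(2)[THEN vimage_borel[OF cont(1)]] diff_borel(3)[THEN vimage_borel[OF cont(2)]]
      diff_borel(4)[THEN vimage_borel[OF cont(4)]] diff_borel(5)[THEN vimage_borel[OF cont(5)]]
      diff_borel(6)[THEN vimage_borel[OF cont(6)]]
    have "{(x, y, t). (x, y) \<in> E \<and> (x + t, y) \<in> E \<and> (x, y + t) \<in> E} =
        XY -` E \<inter> (YZ -` E2 \<inter> XZ -` E3)"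
      by (auto simp: XY_def YZ_def XZ_def E2_def E3_def algebra_simps)
    then have corner_borel: "{(x, y, t). (x, y) \<in> E \<and> (x + t, y) \<in> E \<and> (x, y + t) \<in> E} \<in> sets borel"
      using vimage_borel[OF cont(4) E] vimage_borel[OF cont(5) sets(1)] vimage_borel[OF cont(6) sets(2)] by simp
    have Q_iff2: "Q (\<phi> (fst p)) (\<phi> (snd p)) (\<phi> (fst p + snd p)) \<longleftrightarrow> p \<in> R S1 \<and> yz p \<in> R S2 \<and> xz p \<in> R S3" for p
      using R_iff[OF sub(1), of "fst p" "snd p"] by (simp add: Q_def yz_def xz_def R_iff[OF sub(2)] R_iff[OF sub(3)])
    have "{p. Q (\<phi> (fst p)) (\<phi> (snd p)) (\<phi> (fst p + snd p))} = R S1 \<inter> (yz -` R S2 \<inter> xz -` R S3)"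
      using Q_iff2 by auto
    then have Q_borel2: "{p. Q (\<phi> (fst p)) (\<phi> (snd p)) (\<phi> (fst p + snd p))} \<in> sets borel"
      using R_borel vimage_borel[OF cont(1)] vimage_borel[OF cont(2)] by simp
    \<comment> \<open>For \<open>p \<in> E\<close> both \<open>yz p \<in> E2\<close> and
      \<open>xz p \<in> E3\<close> hold, since each reduces to \<open>p \<in> E\<close>. So only
      approximation errors separate \<open>E\<close> from the approximated degenerate
      triangles.\<close>
    have "measure m2 E \<le> measure m2 ({p. Q (\<phi> (fst p)) (\<phi> (snd p)) (\<phi> (fst p + snd p))} \<union>
        ((E - R S1) \<union> (yz -` (E2 - R S2) \<union> xz -` (E3 - R S3))))"
    proof (rule M2.finite_measure_mono)
      show "E \<subseteq> {p. Q (\<phi> (fst p)) (\<phi> (snd p)) (\<phi> (fst p + snd p))} \<union>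
        ((E - R S1) \<union> (yz -` (E2 - R S2) \<union> xz -` (E3 - R S3)))"
        unfolding Q_iff2 by (auto simp: yz_def xz_def E2_def E3_def)
    qed (use Q_borel2 diff_borel in simp)
    also have "\<dots> \<le> measure m2 {p. Q (\<phi> (fst p)) (\<phi> (snd p)) (\<phi> (fst p + snd p))} + (e + (e + e))"
      using S1(3) S2(3) S3(3) diff_borel Q_borel2
      by (intro M2.measure_Un4_le) (auto simp: push less_imp_le)
    also have "measure m2 {p. Q (\<phi> (fst p)) (\<phi> (snd p)) (\<phi> (fst p + snd p))} =
        W.coupled (\<lambda>s t u. A s t * B t u * C s u)"
      unfolding W.coupled_def ABC \<rho>_def \<phi>_def
      by (rule measure_atoms[OF M2.finite_measure_axioms _ \<U>]) (auto intro!: continuous_intros)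
    finally have "\<epsilon> / 2 \<le> W.coupled (\<lambda>s t u. A s t * B t u * C s u)" using e large by linarith
    from \<delta>(2)[rule_format, OF W.coupling_axioms unit this]
    have "\<delta> \<le> (\<Sum>s\<in>Pow \<U>. \<Sum>t\<in>Pow \<U>. \<Sum>u\<in>Pow \<U>. w s * w t * w u * of_bool (Q s t u))"
      by (simp add: W.triangles_def ABC)
    \<comment> \<open>\<open>XYZ\<close> preserves \<open>m3\<close>, so under \<open>m3\<close> the
      coordinates x, y, z = x + y + t are independent and product weights are measures of
      cells.\<close>
    also have "\<dots> = (\<Sum>s\<in>Pow \<U>. \<Sum>t\<in>Pow \<U>. \<Sum>u\<in>Pow \<U>.
        measure m3 {p. \<phi> (fst p) = s \<and> \<phi> (fst (snd p)) = t \<and>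
          \<phi> (fst p + fst (snd p) + snd (snd p)) = u} * of_bool (Q s t u))"
    proof (intro sum.cong refl arg_cong2[where f = "(*)"])
      fix s t u
      have "{p. \<phi> (fst p) = s \<and> \<phi> (fst (snd p)) = t \<and> \<phi> (fst p + fst (snd p) + snd (snd p)) = u} =
          XYZ -` ({x. \<phi> x = s} \<times> {x. \<phi> x = t} \<times> {x. \<phi> x = u})"
        by (auto simp: XYZ_def)
      then show "w s * w t * w u = measure m3 {p. \<phi> (fst p) = s \<and> \<phi> (fst (snd p)) = t \<and>
          \<phi> (fst p + fst (snd p) + snd (snd p)) = u}"
        by (simp add: push3 prod3 rect atom1 w_def)
    qed
    also have "\<dots> = measure m3 {p. Q (\<phi> (fst p)) (\<phi> (fst (snd p))) (\<phi> (fst p + fst (snd p) + snd (snd p)))}"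
      unfolding \<phi>_def
      by (rule measure_atoms[OF M3.finite_measure_axioms _ \<U>, symmetric]) (auto intro!: continuous_intros)
    also have "\<dots> \<le> measure m3 ({(x, y, t). (x, y) \<in> E \<and> (x + t, y) \<in> E \<and> (x, y + t) \<in> E} \<union>
        (XY -` (R S1 - E) \<union> (YZ -` (R S2 - E2) \<union> XZ -` (R S3 - E3))))"
    proof (rule M3.finite_measure_mono)
      show "{p. Q (\<phi> (fst p)) (\<phi> (fst (snd p))) (\<phi> (fst p + fst (snd p) + snd (snd p)))} \<subseteq>
        {(x, y, t). (x, y) \<in> E \<and> (x + t, y) \<in> E \<and> (x, y + t) \<in> E} \<union>
        (XY -` (R S1 - E) \<union> (YZ -` (R S2 - E2) \<union> XZ -` (R S3 - E3)))"
      proof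
        fix p assume p: "p \<in> {p. Q (\<phi> (fst p)) (\<phi> (fst (snd p))) (\<phi> (fst p + fst (snd p) + snd (snd p)))}"
        obtain x y t where xyt: "p = (x, y, t)" by (cases p) auto
        have "XY p \<in> R S1" "YZ p \<in> R S2" "XZ p \<in> R S3"
          using p by (simp_all only: XY_def YZ_def XZ_def R_iff[OF sub(1)] R_iff[OF sub(2)] R_iff[OF sub(3)] Q_def mem_Collect_eq)
        moreover have "XY p \<in> E \<longleftrightarrow> (x, y) \<in> E" "YZ p \<in> E2 \<longleftrightarrow> (x + t, y) \<in> E" "XZ p \<in> E3 \<longleftrightarrow> (x, y + t) \<in> E"
          by (simp_all add: xyt XY_def YZ_def XZ_def E2_def E3_def algebra_simps)
        ultimately show "p \<in> {(x, y, t). (x, y) \<in> E \<and> (x + t, y) \<in> E \<and> (x, y + t) \<in> E} \<union>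
          (XY -` (R S1 - E) \<union> (YZ -` (R S2 - E2) \<union> XZ -` (R S3 - E3)))"
          unfolding xyt by blast
      qed
    qed (use corner_borel diff_borel in simp)
    also have "\<dots> \<le> measure m3 {(x, y, t). (x, y) \<in> E \<and> (x + t, y) \<in> E \<and> (x, y + t) \<in> E} + (e + (e + e))"
      using S1(4) S2(4) S3(4) diff_borel corner_borel
      by (intro M3.measure_Un4_le) (auto simp: push less_imp_le)
    finally show "\<delta> / 2 \<le> measure m3 {(x, y, t). (x, y) \<in> E \<and> (x + t, y) \<in> E \<and> (x, y + t) \<in> E}"
      using e by linarith
  qed
qed

section \<open>From sets to functions\<close>

theorem theorem5p5:
  fixes m2 :: "('a::{topological_ab_group_add, t2_space} \<times> 'a) measure"
    and m3 :: "('a \<times> 'a \<times> 'a) measure"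
    and \<epsilon> :: real
  assumes "compact (UNIV :: 'a set)"
    and "haar_prob_measure m2"
    and "haar_prob_measure m3"
    and "\<epsilon> > 0"
  shows "\<exists>\<delta>>0. \<forall>F :: 'a \<times> 'a \<Rightarrow> real.
           F \<in> borel_measurable borel \<longrightarrow>
           (\<forall>p. F p \<in> {0..1}) \<longrightarrow>
           (\<integral>p. F p \<partial>m2) \<ge> \<epsilon> \<longrightarrow>
           (\<integral>(x, y, t). F (x, y) * F (x + t, y) * F (x, y + t) \<partial>m3) \<ge> \<delta>"
proof -
  have comp2: "compact (UNIV :: ('a \<times> 'a) set)"
    using compact_Times[OF assms(1,1)] by simp
  have comp3: "compact (UNIV :: ('a \<times> 'a \<times> 'a) set)"
    using compact_Times[OF assms(1) comp2] by simp
  interpret M2: prob_space m2 using assms(2) by (simp add: haar_prob_measure_def)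
  interpret M3: prob_space m3 using assms(3) by (simp add: haar_prob_measure_def)
  have sets [simp]: "sets m2 = sets borel" "sets m3 = sets borel"
    using assms(2,3) by (auto simp: haar_prob_measure_def regular_borel_measure_def)
  obtain \<delta> where \<delta>: "0 < \<delta>" "\<forall>E\<in>sets borel. \<epsilon> / 2 \<le> measure m2 E \<longrightarrow>
      \<delta> \<le> measure m3 {(x, y, t). (x, y) \<in> E \<and> (x + t, y) \<in> E \<and> (x, y + t) \<in> E}"
    using corner_sets[OF assms(1) haar_like_haar[OF comp2 assms(2)] haar_like_haar[OF comp3 assms(3)]
        half_gt_zero[OF assms(4)]] by auto
  show ?thesis
  \<comment> \<open>A corner in the level set of \<open>F\<close> at height
    \<open>\<epsilon> / 2\<close> contributes at least the cube of that height to the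
    integrand.\<close>
  proof (intro exI[of _ "(\<epsilon> / 2) ^ 3 * \<delta>"] conjI allI impI)
    show "0 < (\<epsilon> / 2) ^ 3 * \<delta>" using \<delta>(1) assms(4) by simp
    fix F :: "'a \<times> 'a \<Rightarrow> real"
    assume F: "F \<in> borel_measurable borel" and F01: "\<forall>p. F p \<in> {0..1}" and large: "\<epsilon> \<le> (\<integral>p. F p \<partial>m2)"
    have F0: "0 \<le> F p" and F1: "F p \<le> 1" for p using F01[rule_format, of p] by simp_all
    \<comment> \<open>Values below \<open>\<epsilon> / 2\<close> account for at most
      \<open>\<epsilon> / 2\<close> of the integral and \<open>F\<close> is at most 1, so
      \<open>E\<close> has measure at least \<open>\<epsilon> / 2\<close>.\<close>
    define E where "E = {p. \<epsilon> / 2 \<le> F p}"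
    have E: "E \<in> sets borel"
      using measurable_sets[OF F, of "{\<epsilon> / 2..}"] by (simp add: E_def vimage_def)
    have F_m2: "F \<in> borel_measurable m2" using F by (simp cong: measurable_cong_sets)
    have "(\<integral>p. F p \<partial>m2) \<le> (\<integral>p. \<epsilon> / 2 + indicator E p \<partial>m2)"
    proof (rule integral_mono)
      show "integrable m2 F" using F0 F1 F_m2 by (intro M2.integrable_const_bound[of _ 1]) auto
      show "integrable m2 (\<lambda>p. \<epsilon> / 2 + indicator E p)"
        using E by (intro Bochner_Integration.integrable_add integrable_real_indicator) (auto simp: M2.emeasure_eq_measure)
      show "F p \<le> \<epsilon> / 2 + indicator E p" for p
        using F1[of p] assms(4) by (auto simp: E_def indicator_def)
    qed
    also have "\<dots> = \<epsilon> / 2 + measure m2 E"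
      using E by (subst Bochner_Integration.integral_add)
        (auto simp: M2.prob_space M2.emeasure_eq_measure intro!: integrable_real_indicator)
    finally have "\<epsilon> / 2 \<le> measure m2 E" using large by linarith
    define T where "T = {(x, y, t). (x, y) \<in> E \<and> (x + t, y) \<in> E \<and> (x, y + t) \<in> E}"
    have "\<delta> \<le> measure m3 T" using \<delta>(2) E \<open>\<epsilon> / 2 \<le> measure m2 E\<close> by (simp add: T_def)
    let ?f = "\<lambda>p. F (fst p, fst (snd p))" and ?g = "\<lambda>p. F (fst p + snd (snd p), fst (snd p))"
      and ?h = "\<lambda>p. F (fst p, fst (snd p) + snd (snd p))"
    have comp_meas: "(\<lambda>p. F (k p)) \<in> borel_measurable m3" if "continuous_on UNIV k" for k
      using measurable_compose[OF borel_measurable_continuous_onI[OF that] F] by (simp cong: measurable_cong_sets)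
    have meas: "?f \<in> borel_measurable m3" "?g \<in> borel_measurable m3" "?h \<in> borel_measurable m3"
      by (intro comp_meas continuous_intros)+
    have T_eq: "T = {p \<in> space m3. \<epsilon> / 2 \<le> ?f p \<and> \<epsilon> / 2 \<le> ?g p \<and> \<epsilon> / 2 \<le> ?h p}"
      using sets_eq_imp_space_eq[OF sets(2)] by (auto simp: T_def E_def)
    have T: "T \<in> sets m3"
      unfolding T_eq using meas by measurable
    have "(\<epsilon> / 2) ^ 3 * \<delta> \<le> (\<epsilon> / 2) ^ 3 * measure m3 T"
      using \<open>\<delta> \<le> measure m3 T\<close> assms(4) by (intro mult_left_mono) auto
    also have "\<dots> = (\<integral>p. (\<epsilon> / 2) ^ 3 * indicator T p \<partial>m3)"
      using T by simp
    also have "\<dots> \<le> (\<integral>p. ?f p * ?g p * ?h p \<partial>m3)"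
    proof (rule integral_mono)
      show "integrable m3 (\<lambda>p. (\<epsilon> / 2) ^ 3 * indicator T p)"
        using T by (intro integrable_mult_right integrable_real_indicator) (auto simp: M3.emeasure_eq_measure)
      show "integrable m3 (\<lambda>p. ?f p * ?g p * ?h p)"
      proof (rule M3.integrable_const_bound[of _ 1])
        show "AE p in m3. norm (?f p * ?g p * ?h p) \<le> 1"
          using F0 F1 by (auto simp: abs_mult intro!: AE_I2 mult_le_one)
      qed (use meas in measurable)
      fix p
      show "(\<epsilon> / 2) ^ 3 * indicator T p \<le> ?f p * ?g p * ?h p"
      proof (cases "p \<in> T")
        case True
        then have "\<epsilon> / 2 * (\<epsilon> / 2) * (\<epsilon> / 2) \<le> ?f p * ?g p * ?h p"
          unfolding T_eq using assms(4) F0 by (intro mult_mono mult_nonneg_nonneg) auto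
        then show ?thesis using True by (simp add: power3_eq_cube)
      next
        case False
        then show ?thesis using F0 by simp
      qed
    qed
    finally show "(\<integral>(x, y, t). F (x, y) * F (x + t, y) * F (x, y + t) \<partial>m3) \<ge> (\<epsilon> / 2) ^ 3 * \<delta>"
      by (simp add: case_prod_unfold)
  qed
qed

end
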